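(* Let $\nu,\beta\in(0,1)$ and $\lambda>0$. Consider the generalized Yule model in which genera appear following the mixed Poisson process up to a time transformation $M$ with parameter $\nu$, and the number of species in each genus evolves as an independent copy of the time-fractional pure birth process $\mathcal{Y}$ with constant rates $\lambda_k=\lambda$, $k\ge1$, and fractional exponent $\beta$ (that is, a time-fractional Poisson process of parameters $\lambda$ and $\beta$ shifted upwards by one). For $t>0$ let ${}_t\mathfrak{N}$ be the number of species at time $t$ in a genus chosen uniformly at random among those that have appeared up to time $t$. Then, for every $t>0$ and every integer $k\ge 1$, $$\mathbb{P}({}_t\mathfrak{N}=k)=\Gamma(\nu+1)\,\lambda^{k-1}\,t^{\beta k-\beta}\,E^{k}_{\beta,\,\beta k-\beta+\nu+1}(-\lambda t^\beta).$$
   Context: Prabhakar function: $E^{\gamma}_{\beta,\delta}(z)=\sum_{r=0}^\infty \frac{(\gamma)_r z^r}{r!\,\Gamma(\beta r+\delta)}$, with $(\gamma)_r=\Gamma(\gamma+r)/\Gamma(\gamma)$. Genera process $M$ with parameter $\nu\in(0,1)$: $M_t=N_{Wq(t)}$, where $N$ is a unit-rate homogeneous Poisson process, $q(t)=\mu t^\nu/\Gamma(1+\nu)$ for some constant $\mu>0$, and $W$ is a non-negative random variable independent of $N$, with density $f_W(w)=\frac{1}{\Gamma(1+\nu)}\phi\left(-\nu,1-\nu;\frac{-w}{\Gamma(1+\nu)}\right)$, $w>0$, $\phi(\alpha,\beta;z)=\sum_{r\ge0}\frac{z^r}{r!\,\Gamma(\alpha r+\beta)}$ being the Wright function. The jump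 times of $M$ are the times of appearance of genera. Species process $\mathcal{Y}$: let $(\widetilde N_t)_{t\ge0}$ be a homogeneous Poisson process of rate $\lambda$, let $(D_t)_{t\ge0}$ be an independent $\beta$-stable subordinator with Lévy measure $\frac{\beta}{\Gamma(1-\beta)}x^{-1-\beta}dx$ on $(0,\infty)$ and no drift, and $E_t=\inf\{s:D_s>t\}$. Then $\mathcal{Y}_t=1+\widetilde N_{E_t}$. Generalized Yule model: genera appear at the jump times of $M$; at the appearance time $T_i$ of the $i$-th genus a copy $\mathcal{Y}^{(i)}$ of $\mathcal{Y}$ starts (from a single species), so that the number of species in genus $i$ at time $t\ge T_i$ is $\mathcal{Y}^{(i)}_{t-T_i}$; the copies are independent of one another and of $M$. The random variable ${}_t\mathfrak{N}$ is defined conditionally on $M_t\ge1$: given $M_t\geq 1$, an index is chosen uniformly at random in $\{1,\dots,M_t\}$ (independently of everything else given $M_t$) and ${}_t\mathfrak{N}$ is the number of species at time $t$ in that genus; $\mathbb{P}({}_t\mathfrak{N}=k)$ is the corresponding conditional probability. *)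

theory Defs
  imports "HOL-Probability.Probability"
begin

text \<open>Stochastic processes are families indexed by real time, of which only the times
  \<open>t \<ge> 0\<close> matter.  Path regularity is required for every sample point, so that
  processes evaluated at random times are measurable without completing the measure.\<close>

section \<open>Special functions\<close>

text \<open>The reciprocal Gamma function \<open>rGamma\<close> vanishes at the poles of \<open>Gamma\<close>, which is the
  usual convention for the coefficients of the Wright function.\<close>

definition prabhakar :: "real \<Rightarrow> real \<Rightarrow> real \<Rightarrow> real \<Rightarrow> real" where
  "prabhakar \<gamma> \<beta> \<delta> z =
     (\<Sum>r. pochhammer \<gamma> r * z ^ r / fact r * rGamma (\<beta> * real r + \<delta>))"

definition wright :: "real \<Rightarrow> real \<Rightarrow> real \<Rightarrow> real" where
  "wright \<alpha> \<beta> z = (\<Sum>r. z ^ r / fact r * rGamma (\<alpha> * real r + \<beta>))"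

section \<open>Processes with independent increments\<close>

definition process_events ::
    "'a measure \<Rightarrow> (real \<Rightarrow> 'a \<Rightarrow> 'b::topological_space) \<Rightarrow> 'a set set" where
  "process_events P X = sigma_sets (space P)
     {X t -` A \<inter> space P | t A. 0 \<le> t \<and> A \<in> sets borel}"

definition indep_increments :: "'a measure \<Rightarrow> (real \<Rightarrow> 'a \<Rightarrow> real) \<Rightarrow> bool" where
  "indep_increments P X \<longleftrightarrow>
     (\<forall>n. \<forall>\<tau> :: nat \<Rightarrow> real. 0 \<le> \<tau> 0 \<and> mono \<tau> \<longrightarrow>
        prob_space.indep_vars P (\<lambda>_. borel) (\<lambda>i \<omega>. X (\<tau> (Suc i)) \<omega> - X (\<tau> i) \<omega>) {..<n})"

definition increasing_rc_path :: "(real \<Rightarrow> 'b::{linorder_topology, zero}) \<Rightarrow> bool" where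
  "increasing_rc_path x \<longleftrightarrow>
     x 0 = 0 \<and> mono_on {0..} x \<and> (\<forall>t\<ge>0. continuous (at_right t) x)"

definition poisson_process :: "'a measure \<Rightarrow> real \<Rightarrow> (real \<Rightarrow> 'a \<Rightarrow> nat) \<Rightarrow> bool" where
  "poisson_process P rate N \<longleftrightarrow>
     (\<forall>t\<ge>0. N t \<in> borel_measurable P) \<and>
     (\<forall>\<omega>\<in>space P. increasing_rc_path (\<lambda>t. N t \<omega>)) \<and>
     indep_increments P (\<lambda>t \<omega>. real (N t \<omega>)) \<and>
     (\<forall>s u. 0 \<le> s \<and> s < u \<longrightarrow>
        distr P (count_space UNIV) (\<lambda>\<omega>. N u \<omega> - N s \<omega>)
          = measure_pmf (poisson_pmf (rate * (u - s))))"

text \<open>Drift and Levy measure of a subordinator are those of its Levy-Khintchine formula.\<close>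

definition subordinator ::
    "'a measure \<Rightarrow> real \<Rightarrow> real measure \<Rightarrow> (real \<Rightarrow> 'a \<Rightarrow> real) \<Rightarrow> bool" where
  "subordinator P d L D \<longleftrightarrow>
     0 \<le> d \<and> sets L = sets borel \<and> emeasure L {..0} = 0 \<and> integrable L (\<lambda>x. min 1 x) \<and>
     (\<forall>s\<ge>0. D s \<in> borel_measurable P) \<and>
     (\<forall>\<omega>\<in>space P. increasing_rc_path (\<lambda>s. D s \<omega>)) \<and>
     indep_increments P D \<and>
     (\<forall>s u. 0 \<le> s \<and> s \<le> u \<longrightarrow>
        distr P borel (\<lambda>\<omega>. D u \<omega> - D s \<omega>) = distr P borel (D (u - s))) \<and>
     (\<forall>s\<ge>0. \<forall>\<theta>\<ge>0. (\<integral>\<omega>. exp (- \<theta> * D s \<omega>) \<partial>P)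
        = exp (- s * (d * \<theta> + (\<integral>x. (1 - exp (- \<theta> * x)) \<partial>L))))"

definition stable_levy_measure :: "real \<Rightarrow> real measure" where
  "stable_levy_measure \<beta> = density lborel
     (\<lambda>x. ennreal (if 0 < x then \<beta> / Gamma (1 - \<beta>) * x powr (- 1 - \<beta>) else 0))"

definition stable_subordinator :: "'a measure \<Rightarrow> real \<Rightarrow> (real \<Rightarrow> 'a \<Rightarrow> real) \<Rightarrow> bool" where
  "stable_subordinator P \<beta> D \<longleftrightarrow> subordinator P 0 (stable_levy_measure \<beta>) D"

text \<open>The set below is empty only on the null event that \<open>D\<close> stays bounded by \<open>t\<close>; there the
  value is 0 by convention.\<close>

definition inverse_process :: "(real \<Rightarrow> 'a \<Rightarrow> real) \<Rightarrow> real \<Rightarrow> 'a \<Rightarrow> real" where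
  "inverse_process D t \<omega> =
     (if \<exists>s\<ge>0. D s \<omega> > t then Inf {s. 0 \<le> s \<and> D s \<omega> > t} else 0)"

section \<open>The generalized Yule model\<close>

definition genera_mixing_density :: "real \<Rightarrow> real \<Rightarrow> real" where
  "genera_mixing_density \<nu> w =
     (if 0 < w then 1 / Gamma (1 + \<nu>) * wright (- \<nu>) (1 - \<nu>) (- w / Gamma (1 + \<nu>)) else 0)"

definition genera_process :: "'a measure \<Rightarrow> real \<Rightarrow> (real \<Rightarrow> 'a \<Rightarrow> nat) \<Rightarrow> bool" where
  "genera_process P \<nu> M \<longleftrightarrow>
     (\<exists>\<mu>>0. \<exists>N W. poisson_process P 1 N \<and>
        (\<forall>\<omega>\<in>space P. 0 \<le> W \<omega>) \<and>
        distributed P lborel W (\<lambda>w. ennreal (genera_mixing_density \<nu> w)) \<and>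
        prob_space.indep_set P (process_events P N) {W -` A \<inter> space P | A. A \<in> sets borel} \<and>
        (\<forall>t\<ge>0. \<forall>\<omega>\<in>space P. M t \<omega> = N (W \<omega> * (\<mu> * t powr \<nu> / Gamma (1 + \<nu>))) \<omega>))"

definition species_process ::
    "'a measure \<Rightarrow> real \<Rightarrow> real \<Rightarrow> (real \<Rightarrow> 'a \<Rightarrow> nat) \<Rightarrow> bool" where
  "species_process P lam \<beta> Y \<longleftrightarrow>
     (\<exists>N D. poisson_process P lam N \<and> stable_subordinator P \<beta> D \<and>
        prob_space.indep_set P (process_events P N) (process_events P D) \<and>
        (\<forall>t\<ge>0. \<forall>\<omega>\<in>space P. Y t \<omega> = 1 + N (inverse_process D t \<omega>) \<omega>))"

text \<open>Genera are numbered from 1; in the independence condition the index 0 stands for the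
  process of genera.\<close>

definition generalized_yule_model ::
    "'a measure \<Rightarrow> real \<Rightarrow> real \<Rightarrow> real \<Rightarrow> (real \<Rightarrow> 'a \<Rightarrow> nat) \<Rightarrow> (nat \<Rightarrow> real \<Rightarrow> 'a \<Rightarrow> nat) \<Rightarrow> bool" where
  "generalized_yule_model P \<nu> lam \<beta> M Y \<longleftrightarrow>
     prob_space P \<and> genera_process P \<nu> M \<and> (\<forall>i\<ge>1. species_process P lam \<beta> (Y i)) \<and>
     prob_space.indep_sets P (\<lambda>i. process_events P (if i = 0 then M else Y i)) UNIV"

definition appearance_time :: "(real \<Rightarrow> 'a \<Rightarrow> nat) \<Rightarrow> nat \<Rightarrow> 'a \<Rightarrow> real" where
  "appearance_time M i \<omega> = Inf {s. 0 \<le> s \<and> i \<le> M s \<omega>}"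

text \<open>\<open>J\<close> is the index of the chosen genus: given \<open>M t = n \<ge> 1\<close> it is uniform on \<open>{1..n}\<close> and
  independent of the events of the whole model.\<close>

definition uniform_genus_index ::
    "'a measure \<Rightarrow> (real \<Rightarrow> 'a \<Rightarrow> nat) \<Rightarrow> (nat \<Rightarrow> real \<Rightarrow> 'a \<Rightarrow> nat) \<Rightarrow> real \<Rightarrow> ('a \<Rightarrow> nat) \<Rightarrow> bool" where
  "uniform_genus_index P M Y t J \<longleftrightarrow>
     J \<in> borel_measurable P \<and>
     (\<forall>\<omega>\<in>space P. 1 \<le> M t \<omega> \<longrightarrow> J \<omega> \<in> {1..M t \<omega>}) \<and>
     (\<forall>n\<ge>1. \<forall>j\<in>{1..n}. \<P>(\<omega> in P. J \<omega> = j \<bar> M t \<omega> = n) = 1 / real n) \<and>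
     (\<forall>n\<ge>1. \<forall>j\<in>{1..n}.
        \<forall>A\<in>sigma_sets (space P) (process_events P M \<union> (\<Union>i\<in>{1..}. process_events P (Y i))).
          \<P>(\<omega> in P. J \<omega> = j \<and> \<omega> \<in> A \<bar> M t \<omega> = n)
            = \<P>(\<omega> in P. J \<omega> = j \<bar> M t \<omega> = n) * \<P>(\<omega> in P. \<omega> \<in> A \<bar> M t \<omega> = n))"

definition chosen_genus_size ::
    "(real \<Rightarrow> 'a \<Rightarrow> nat) \<Rightarrow> (nat \<Rightarrow> real \<Rightarrow> 'a \<Rightarrow> nat) \<Rightarrow> real \<Rightarrow> ('a \<Rightarrow> nat) \<Rightarrow> 'a \<Rightarrow> nat" where
  "chosen_genus_size M Y t J \<omega> = Y (J \<omega>) (t - appearance_time M (J \<omega>) \<omega>) \<omega>"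

end

theory Submission
  imports Defs
begin

text \<open>Given \<open>W\<close>, the genera form a Poisson process with mean function proportional to \<open>t\<^sup>\<nu>\<close>, so by binomial
  thinning the number of genera at time \<open>s\<close> given \<open>n\<close> genera at time \<open>t\<close> is binomial with parameter
  \<open>(s / t)\<^sup>\<nu>\<close>, whatever the law of \<open>W\<close>.  Hence the age \<open>A\<close> at time \<open>t\<close> of a uniformly chosen genus satisfies
  \<open>P(A \<ge> x) = ((t - x) / t)\<^sup>\<nu>\<close>, and its moments are Beta integrals.

  The stable subordinator satisfies \<open>D s = s\<^bsup>1/\<beta>\<^esup> D 1\<close> in law, so its inverse at time \<open>u\<close> has the moments of
  \<open>u\<^sup>\<beta> (D 1)\<^bsup>-\<beta>\<^esup>\<close>, namely \<open>r! u\<^bsup>\<beta>r\<^esup> / \<Gamma>(\<beta>r + 1)\<close>.  Expanding the Poisson probabilities in a power series gives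
  the law of the number of species of a genus of age \<open>u\<close> as a power series in \<open>u\<^sup>\<beta>\<close>.  Integrating it term by
  term against the law of \<open>A\<close> replaces \<open>1 / \<Gamma>(\<beta>r + 1)\<close> by \<open>\<Gamma>(\<nu> + 1) / \<Gamma>(\<beta>r + \<nu> + 1)\<close>, which is
  the Prabhakar series.\<close>

text \<open>The obstacle is randomness in the time argument: a Poisson process is read at a multiple
  of \<open>W\<close>, another one at the inverse of \<open>D\<close>, and \<open>Y j\<close> at the
  age of genus \<open>j\<close>. Each time the process is locally constant to the right and
  independent of the time, so one Fubini statement serves all three. It is phrased with
  sub-sigma-algebras, because \<open>J\<close> is independent only of events of the model, and
  events built from a random age must be recognised as such. The ages of individual genera differ in
  law. Their sum over \<open>j\<close> is simple, since summing the indicators of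
  \<open>j \<le> M s\<close> gives back the number of genera at time \<open>s\<close>, of which only
  the binomial mean matters. Ages are therefore carried as sums over \<open>j = 1..n\<close> on the
  event \<open>M t = n\<close>. The result is \<open>n\<close> times the probability of that event
  times a factor free of \<open>n\<close>, so the conditional law is the same for every
  \<open>n\<close> and survives conditioning on \<open>1 \<le> M t\<close>. Infinite sums and
  integrals are exchanged by absolute convergence: Gamma outgrows every exponential, which also
  absorbs the binomial coefficients.\<close>

section \<open>Gamma and Beta integrals\<close>

text \<open>Only the part of the Gamma integral over \<open>[A, A + 1]\<close> is kept, and both
  factors of the integrand are replaced by their lower bounds there. Since \<open>A\<close> is free,
  Gamma outgrows every exponential.\<close>

lemma Gamma_ge_powr:
  fixes x A :: real
  assumes "1 \<le> x" "0 < A"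
  shows "A powr (x - 1) * exp (- (A + 1)) \<le> Gamma x"
proof -
  let ?c = "A powr (x - 1) * exp (- (A + 1))"
  have "((\<lambda>u. ?c) has_integral ?c) {A..A+1}"
    using has_integral_const_real[of ?c A "A + 1"] by simp
  then have "((\<lambda>u. if u \<in> {A..A+1} then ?c else 0) has_integral ?c) {0..}"
    using assms by (subst has_integral_restrict) auto
  moreover have "((\<lambda>u. u powr (x - 1) / exp u) has_integral Gamma x) {0..}"
    using Gamma_integral_real[of x] assms by simp
  ultimately show ?thesis
  proof (rule has_integral_le)
    fix u :: real assume "u \<in> {0..}"
    have "?c \<le> u powr (x - 1) * exp (- u)" if "u \<in> {A..A+1}"
      using that assms by (intro mult_mono powr_mono2) auto
    then show "(if u \<in> {A..A+1} then ?c else 0) \<le> u powr (x - 1) / exp u"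
      by (auto simp: exp_minus divide_inverse)
  qed
qed

text \<open>The base \<open>A\<close> of the lower bound for Gamma can be adapted to
  \<open>y\<close>, so the series converges for every real \<open>y\<close>. All later exchanges of
  an infinite sum with an integral go back to this fact.\<close>

lemma summable_power_rGamma:
  fixes y b c :: real
  assumes "0 < b" "0 < c"
  shows "summable (\<lambda>i. y ^ i * rGamma (b * real i + c))"
proof -
  \<comment> \<open>With \<open>A powr b = 2 * \<bar>y\<bar> + 1\<close> the terms are bounded by a
    geometric sequence of ratio \<open>\<bar>y\<bar> / (2 * \<bar>y\<bar> + 1)\<close>, which is
    below 1/2. The summand 1 keeps \<open>A\<close> positive when \<open>y = 0\<close>.\<close>
  define A where "A = (2 * \<bar>y\<bar> + 1) powr (1 / b)"
  have A: "0 < A" "A powr b = 2 * \<bar>y\<bar> + 1" using assms by (auto simp: A_def powr_powr)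
  define C where "C = exp (A + 1) * A powr (1 - c)"
  \<comment> \<open>From \<open>n0\<close> on, \<open>b * i\<close> is at least 1, so the argument
    of Gamma lies in the range of the lower bound.\<close>
  obtain n0 :: nat where n0: "1 / b \<le> real n0" using real_arch_simple by blast
  have "summable (\<lambda>i. C * (1 / 2) ^ i)" by (intro summable_mult summable_geometric) auto
  moreover have "norm (y ^ i * rGamma (b * real i + c)) \<le> C * (1 / 2) ^ i" if "n0 \<le> i" for i
  proof -
    have "1 / b \<le> real i" using n0 that by linarith
    then have "1 \<le> b * real i" using assms by (simp add: field_simps)
    then have ge: "1 \<le> b * real i + c" using assms by simp
    have "A powr (b * real i + c - 1) * exp (- (A + 1)) \<le> Gamma (b * real i + c)"
      by (rule Gamma_ge_powr[OF ge A(1)])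
    then have "inverse (Gamma (b * real i + c)) \<le> inverse (A powr (b * real i + c - 1) * exp (- (A + 1)))"
      by (rule le_imp_inverse_le) (use A in simp)
    also have "\<dots> = C * (1 / (2 * \<bar>y\<bar> + 1)) ^ i"
    proof -
      have "A powr (b * real i + c - 1) = (2 * \<bar>y\<bar> + 1) ^ i * A powr (c - 1)"
        using A by (simp add: powr_add[symmetric] powr_powr[symmetric] powr_realpow[symmetric] add_diff_eq[symmetric] powr_add)
      then show ?thesis using A
        by (simp add: C_def exp_minus[of "A + 1", simplified] powr_minus[of A "c - 1", simplified] power_divide inverse_eq_divide)
    qed
    finally have r: "rGamma (b * real i + c) \<le> C * (1 / (2 * \<bar>y\<bar> + 1)) ^ i"
      by (simp add: rGamma_inverse_Gamma)
    have pos: "0 \<le> rGamma (b * real i + c)" using ge Gamma_real_pos[of "b * real i + c"] by (simp add: rGamma_inverse_Gamma)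
    have "norm (y ^ i * rGamma (b * real i + c)) = \<bar>y\<bar> ^ i * rGamma (b * real i + c)"
      using pos by (simp add: abs_mult power_abs)
    also have "\<dots> \<le> \<bar>y\<bar> ^ i * (C * (1 / (2 * \<bar>y\<bar> + 1)) ^ i)" by (intro mult_left_mono r) auto
    also have "\<dots> = C * (\<bar>y\<bar> / (2 * \<bar>y\<bar> + 1)) ^ i" by (simp add: power_divide)
    also have "\<dots> \<le> C * (1 / 2) ^ i"
      by (intro mult_left_mono power_mono) (auto simp: C_def field_simps)
    finally show ?thesis .
  qed
  ultimately show ?thesis by (rule summable_comparison_test'[rotated 0])
qed

text \<open>A scaling of the Gamma integral. Read from right to left it writes a negative power of
  \<open>\<theta>\<close> as a mixture of exponentials in \<open>\<theta>\<close>, which later turns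
  a Laplace transform into negative moments.\<close>

lemma nn_integral_Gamma_scaled:
  fixes a \<theta> :: real
  assumes "0 < a" "0 < \<theta>"
  shows "(\<integral>\<^sup>+x. ennreal (x powr (a - 1) * exp (- \<theta> * x)) * indicator {0<..} x \<partial>lborel) = ennreal (Gamma a * \<theta> powr (- a))"
proof -
  have "(\<integral>\<^sup>+x. ennreal (indicator {0..} x * x powr (a - 1) / exp x) \<partial>lborel)
     = ennreal \<theta> * (\<integral>\<^sup>+x. ennreal (indicator {0..} (\<theta> * x) * (\<theta> * x) powr (a - 1) / exp (\<theta> * x)) \<partial>lborel)"
    using assms by (subst nn_integral_real_affine[where c=\<theta> and t=0]) (auto simp: )
  also have "\<dots> = (\<integral>\<^sup>+x. ennreal (\<theta> powr a) * (ennreal (x powr (a - 1) * exp (- \<theta> * x)) * indicator {0<..} x) \<partial>lborel)"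
  proof (subst nn_integral_cmult[symmetric], simp, rule nn_integral_cong)
    fix x :: real
    show "ennreal \<theta> * ennreal (indicator {0..} (\<theta> * x) * (\<theta> * x) powr (a - 1) / exp (\<theta> * x)) =
      ennreal (\<theta> powr a) * (ennreal (x powr (a - 1) * exp (- \<theta> * x)) * indicator {0<..} x)"
    proof (cases "0 < x")
      case True
      have "\<theta> * ((\<theta> * x) powr (a - 1) / exp (\<theta> * x)) = \<theta> powr a * (x powr (a - 1) * exp (- \<theta> * x))"
        using True assms by (simp add: powr_mult powr_diff exp_minus divide_simps)
      then show ?thesis using True assms by (simp add: ennreal_mult[symmetric])
    next
      case False
      \<comment> \<open>The two indicators disagree only at \<open>x = 0\<close>, where
        \<open>0 powr (a - 1)\<close> is 0.\<close>
      then show ?thesis using assms by (cases "x = 0") (auto simp: indicator_def zero_le_mult_iff)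
    qed
  qed
  also have "\<dots> = ennreal (\<theta> powr a) * (\<integral>\<^sup>+x. ennreal (x powr (a - 1) * exp (- \<theta> * x)) * indicator {0<..} x \<partial>lborel)"
    by (rule nn_integral_cmult) simp
  finally have eq: "ennreal (Gamma a) = ennreal (\<theta> powr a) * (\<integral>\<^sup>+x. ennreal (x powr (a - 1) * exp (- \<theta> * x)) * indicator {0<..} x \<partial>lborel)"
    using Gamma_conv_nn_integral_real[OF assms(1)] by simp
  have "ennreal (Gamma a * \<theta> powr (- a)) = ennreal (\<theta> powr (- a)) * ennreal (Gamma a)"
    using assms by (simp add: ennreal_mult' mult.commute)
  also have "\<dots> = ennreal (\<theta> powr (- a) * \<theta> powr a) * (\<integral>\<^sup>+x. ennreal (x powr (a - 1) * exp (- \<theta> * x)) * indicator {0<..} x \<partial>lborel)"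
    by (simp add: eq ennreal_mult mult.assoc)
  also have "\<theta> powr (- a) * \<theta> powr a = 1" using assms by (simp add: powr_add[symmetric])
  finally show ?thesis by simp
qed

lemma nn_integral_powr_tail:
  fixes b y :: real
  assumes "0 < b" "0 < y"
  shows "(\<integral>\<^sup>+x. ennreal (b * x powr (- 1 - b)) * indicator {y..} x \<partial>lborel) = ennreal (y powr (- b))"
proof -
  have "(\<integral>\<^sup>+x. ennreal (b * x powr (- 1 - b)) * indicator {y..} x \<partial>lborel) = ennreal (0 - (- (y powr (- b))))"
  proof (rule nn_integral_FTC_atLeast)
    show "((\<lambda>x. - (x powr (- b))) has_real_derivative b * x powr (- 1 - b)) (at x)" if "y \<le> x" for x
      using that assms by (auto intro!: derivative_eq_intros simp: minus_diff_commute)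
    show "((\<lambda>x. - (x powr (- b))) \<longlongrightarrow> 0) at_top"
      using tendsto_minus[OF tendsto_neg_powr[OF _ filterlim_ident, of "-b"]] assms by simp
  qed (use assms in auto)
  then show ?thesis by simp
qed

text \<open>Write \<open>1 - exp (- \<theta> * x)\<close> as the integral of
  \<open>\<theta> * exp (- \<theta> * y)\<close> over \<open>[0, x]\<close> and exchange the
  integrals. The inner integral over \<open>x \<ge> y\<close> is \<open>y powr (- b)\<close>, and
  the remaining Gamma integral has parameter \<open>1 - b\<close>, whose value cancels the
  normalisation of the Levy measure.\<close>

lemma nn_integral_stable_levy_exponent:
  fixes b \<theta> :: real
  assumes "0 < b" "b < 1" "0 < \<theta>"
  shows "(\<integral>\<^sup>+x. ennreal (1 - exp (- \<theta> * x)) \<partial>stable_levy_measure b) = ennreal (\<theta> powr b)"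
proof -
  let ?L = "lborel :: real measure"
  define G where "G = Gamma (1 - b)"
  have G: "0 < G" using assms by (simp add: G_def)
  have "(\<integral>\<^sup>+x. ennreal (1 - exp (- \<theta> * x)) \<partial>stable_levy_measure b) =
      (\<integral>\<^sup>+x. \<integral>\<^sup>+y. ennreal (\<theta> * exp (- \<theta> * y) / G) * (ennreal (b * x powr (- 1 - b)) * indicator {y..} x) * indicator {0<..} y \<partial>?L \<partial>?L)"
    unfolding stable_levy_measure_def
  proof (subst nn_integral_density, simp, simp, rule nn_integral_cong)
    fix x :: real
    show "ennreal (if 0 < x then b / Gamma (1 - b) * x powr (- 1 - b) else 0) * ennreal (1 - exp (- \<theta> * x)) =
       (\<integral>\<^sup>+y. ennreal (\<theta> * exp (- \<theta> * y) / G) * (ennreal (b * x powr (- 1 - b)) * indicator {y..} x) * indicator {0<..} y \<partial>?L)"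
    proof (cases "0 < x")
      case True
      have "(\<integral>\<^sup>+y. ennreal (\<theta> * exp (- \<theta> * y)) * indicator {0..x} y \<partial>?L) = ennreal (- exp (- \<theta> * x) - (- exp (- \<theta> * 0)))"
        by (rule nn_integral_FTC_Icc) (use True assms in \<open>auto intro!: derivative_eq_intros\<close>)
      then have *: "ennreal (1 - exp (- \<theta> * x)) = (\<integral>\<^sup>+y. ennreal (\<theta> * exp (- \<theta> * y)) * indicator {0..x} y \<partial>?L)" by simp
      have "(\<integral>\<^sup>+y. ennreal (\<theta> * exp (- \<theta> * y) / G) * (ennreal (b * x powr (- 1 - b)) * indicator {y..} x) * indicator {0<..} y \<partial>?L)
        = (\<integral>\<^sup>+y. ennreal (b / G * x powr (- 1 - b)) * (ennreal (\<theta> * exp (- \<theta> * y)) * indicator {0..x} y) \<partial>?L)"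
      proof (rule nn_integral_cong_AE)
        have "AE y in ?L. y \<noteq> 0" by (rule AE_lborel_singleton)
        then show "AE y in ?L. ennreal (\<theta> * exp (- \<theta> * y) / G) * (ennreal (b * x powr (- 1 - b)) * indicator {y..} x) * indicator {0<..} y
           = ennreal (b / G * x powr (- 1 - b)) * (ennreal (\<theta> * exp (- \<theta> * y)) * indicator {0..x} y)"
        proof eventually_elim
          case (elim y)
          then show ?case using assms G True
            by (auto simp: indicator_def ennreal_mult[symmetric] field_simps)
        qed
      qed
      also have "\<dots> = ennreal (b / G * x powr (- 1 - b)) * ennreal (1 - exp (- \<theta> * x))"
        by (subst nn_integral_cmult) (use * in simp_all)
      finally show ?thesis using True by (simp add: G_def)
    next
      case False
      then have "ennreal (\<theta> * exp (- \<theta> * y) / G) * (ennreal (b * x powr (- 1 - b)) * indicator {y..} x) * indicator {0<..} y = 0" for y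
        by (auto simp: indicator_def)
      then show ?thesis using False by (simp only: nn_integral_0_iff_AE) simp
    qed
  qed
  also have "\<dots> = (\<integral>\<^sup>+y. \<integral>\<^sup>+x. ennreal (\<theta> * exp (- \<theta> * y) / G) * (ennreal (b * x powr (- 1 - b)) * indicator {y..} x) * indicator {0<..} y \<partial>?L \<partial>?L)"
    by (rule lborel_pair.Fubini') (simp add: indicator_def split_beta)
  also have "\<dots> = (\<integral>\<^sup>+y. ennreal (\<theta> / G) * (ennreal (y powr ((1 - b) - 1) * exp (- \<theta> * y)) * indicator {0<..} y) \<partial>?L)"
  proof (rule nn_integral_cong)
    fix y :: real
    show "(\<integral>\<^sup>+x. ennreal (\<theta> * exp (- \<theta> * y) / G) * (ennreal (b * x powr (- 1 - b)) * indicator {y..} x) * indicator {0<..} y \<partial>?L)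
       = ennreal (\<theta> / G) * (ennreal (y powr ((1 - b) - 1) * exp (- \<theta> * y)) * indicator {0<..} y)"
    proof (cases "0 < y")
      case True
      then have "(\<integral>\<^sup>+x. ennreal (\<theta> * exp (- \<theta> * y) / G) * (ennreal (b * x powr (- 1 - b)) * indicator {y..} x) * indicator {0<..} y \<partial>?L)
        = ennreal (\<theta> * exp (- \<theta> * y) / G) * ennreal (y powr (- b))"
        using assms by (simp add: nn_integral_cmult nn_integral_powr_tail)
      then show ?thesis using True assms G by (simp add: ennreal_mult[symmetric] field_simps)
    qed simp
  qed
  also have "\<dots> = ennreal (\<theta> / G) * ennreal (G * \<theta> powr (- (1 - b)))"
    using assms by (subst nn_integral_cmult) (simp_all only: nn_integral_Gamma_scaled G_def, simp_all)
  also have "\<dots> = ennreal (\<theta> powr b)"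
    using assms G by (simp add: ennreal_mult'[symmetric] powr_diff)
  finally show ?thesis .
qed

lemma integral_stable_levy_exponent:
  fixes b \<theta> :: real
  assumes "0 < b" "b < 1" "0 < \<theta>"
  shows "(\<integral>x. (1 - exp (- \<theta> * x)) \<partial>stable_levy_measure b) = \<theta> powr b"
proof (rule integral_eq_nn_integral[THEN trans])
  show "AE x in stable_levy_measure b. 0 \<le> 1 - exp (- \<theta> * x)"
    unfolding stable_levy_measure_def using assms by (subst AE_density) auto
  show "(\<lambda>x. 1 - exp (- \<theta> * x)) \<in> borel_measurable (stable_levy_measure b)"
    unfolding stable_levy_measure_def by simp
  show "enn2real (\<integral>\<^sup>+x. ennreal (1 - exp (- \<theta> * x)) \<partial>stable_levy_measure b) = \<theta> powr b"
    using nn_integral_stable_levy_exponent[OF assms] by simp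
qed

text \<open>The substitution \<open>y = x powr b\<close> in the Gamma integral. The integrand is
  what remains of a Gamma integral once the Laplace transform \<open>exp (- (x powr b))\<close> of
  \<open>D 1\<close> has been inserted.\<close>

lemma nn_integral_powr_exp_powr:
  fixes a b :: real
  assumes "0 < a" "0 < b"
  shows "(\<integral>\<^sup>+x. ennreal (x powr (b * a - 1) * exp (- (x powr b))) * indicator {0<..} x \<partial>lborel) = ennreal (Gamma a / b)"
proof -
  let ?f = "\<lambda>y::real. y powr (a - 1) / exp y"
  \<comment> \<open>The open half-line is used because \<open>x powr b\<close> need not be
    differentiable at 0.\<close>
  have "(?f has_integral Gamma a) {0<..}"
  proof -
    have "((\<lambda>t. if t \<in> {0<..} then ?f t else 0) has_integral Gamma a) {0..}"
      by (rule has_integral_spike[OF _ _ Gamma_integral_real[OF assms(1)], of "{0}"]) auto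
    then show ?thesis by (subst (asm) has_integral_restrict) auto
  qed
  then have "?f absolutely_integrable_on {0<..} \<and> integral {0<..} ?f = Gamma a"
    by (auto simp: has_integral_iff intro!: nonnegative_absolutely_integrable_1)
  moreover have "(\<lambda>x::real. x powr b) ` {0<..} = {0<..}"
  proof safe
    fix y :: real assume "0 < y"
    then show "y \<in> (\<lambda>x. x powr b) ` {0<..}" using assms
      by (intro image_eqI[where x="y powr (1 / b)"]) (auto simp: powr_powr)
  qed auto
  moreover have "inj_on (\<lambda>x::real. x powr b) {0<..}"
    by (rule inj_on_inverseI[where g="\<lambda>y. y powr (1 / b)"]) (use assms in \<open>auto simp: powr_powr\<close>)
  ultimately have "(\<lambda>x. \<bar>b * x powr (b - 1)\<bar> * ?f (x powr b)) absolutely_integrable_on {0<..} \<and>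
     integral {0<..} (\<lambda>x. \<bar>b * x powr (b - 1)\<bar> * ?f (x powr b)) = Gamma a"
    using has_absolute_integral_change_of_variables_1'[where g="\<lambda>x. x powr b" and g'="\<lambda>x. b * x powr (b - 1)"
        and S="{0<..}" and f="?f" and b="Gamma a"]
      has_field_derivative_at_within[OF has_real_derivative_powr] by simp
  then have "((\<lambda>x. \<bar>b * x powr (b - 1)\<bar> * ?f (x powr b)) has_integral Gamma a) {0<..}"
    by (auto simp: has_integral_iff dest: set_lebesgue_integral_eq_integral(1))
  from nn_integral_has_integral_lebesgue'[OF _ this]
  have "(\<integral>\<^sup>+x. ennreal (\<bar>b * x powr (b - 1)\<bar> * ?f (x powr b)) * indicator {0<..} x \<partial>lborel) = ennreal (Gamma a)"
    by simp
  also have "(\<integral>\<^sup>+x. ennreal (\<bar>b * x powr (b - 1)\<bar> * ?f (x powr b)) * indicator {0<..} x \<partial>lborel)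
    = (\<integral>\<^sup>+x. ennreal b * (ennreal (x powr (b * a - 1) * exp (- (x powr b))) * indicator {0<..} x) \<partial>lborel)"
  proof (rule nn_integral_cong)
    fix x :: real
    show "ennreal (\<bar>b * x powr (b - 1)\<bar> * ?f (x powr b)) * indicator {0<..} x = ennreal b * (ennreal (x powr (b * a - 1) * exp (- (x powr b))) * indicator {0<..} x)"
    proof (cases "0 < x")
      case True
      have "\<bar>b * x powr (b - 1)\<bar> * ?f (x powr b) = b * (x powr (b * a - 1) * exp (- (x powr b)))"
        using True assms by (simp add: abs_mult powr_powr exp_minus powr_add[symmetric] algebra_simps divide_inverse)
      then show ?thesis using True assms by (simp add: ennreal_mult)
    qed simp
  qed
  also have "\<dots> = ennreal b * (\<integral>\<^sup>+x. ennreal (x powr (b * a - 1) * exp (- (x powr b))) * indicator {0<..} x \<partial>lborel)"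
    by (rule nn_integral_cmult) simp
  finally have eq: "ennreal b * (\<integral>\<^sup>+x. ennreal (x powr (b * a - 1) * exp (- (x powr b))) * indicator {0<..} x \<partial>lborel) = ennreal (Gamma a)" .
  have "ennreal (Gamma a / b) = ennreal (1 / b) * ennreal (Gamma a)"
    using assms by (simp add: ennreal_mult[symmetric])
  also have "\<dots> = ennreal (1 / b * b) * (\<integral>\<^sup>+x. ennreal (x powr (b * a - 1) * exp (- (x powr b))) * indicator {0<..} x \<partial>lborel)"
    using assms by (subst ennreal_mult) (simp_all add: eq[symmetric] mult.assoc)
  finally show ?thesis using assms by simp
qed

lemma nn_integral_powr_Icc:
  fixes a z :: real
  assumes "0 < a" "0 \<le> z"
  shows "(\<integral>\<^sup>+x. ennreal (a * x powr (a - 1)) * indicator {0..z} x \<partial>lborel) = ennreal (z powr a)"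
proof -
  have "((\<lambda>x. a * x powr (a - 1)) has_integral a * (z powr (a - 1 + 1) / (a - 1 + 1))) {0..z}"
    by (intro has_integral_mult_right has_integral_powr_from_0) (use assms in auto)
  from nn_integral_has_integral_lebesgue'[OF _ this] assms show ?thesis by simp
qed

section \<open>Moments from tail probabilities\<close>

context prob_space
begin

text \<open>\<open>X powr a\<close> is the integral of \<open>a * x powr (a - 1)\<close> from 0 to
  \<open>X\<close>; then Tonelli. Both the weak and the strict tail are recorded, because the
  inverse of the subordinator is bounded from one side in terms of each.\<close>

lemma nn_integral_powr_layer_cake:
  fixes X :: "'a \<Rightarrow> real"
  assumes X[measurable]: "X \<in> borel_measurable M" and nn: "\<And>\<omega>. \<omega> \<in> space M \<Longrightarrow> 0 \<le> X \<omega>" and a: "0 < a"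
  shows "(\<integral>\<^sup>+\<omega>. ennreal (X \<omega> powr a) \<partial>M)
      = (\<integral>\<^sup>+x. ennreal (a * x powr (a - 1)) * indicator {0<..} x * ennreal (prob {\<omega> \<in> space M. x \<le> X \<omega>}) \<partial>lborel)"
    and "(\<integral>\<^sup>+\<omega>. ennreal (X \<omega> powr a) \<partial>M)
      = (\<integral>\<^sup>+x. ennreal (a * x powr (a - 1)) * indicator {0<..} x * ennreal (prob {\<omega> \<in> space M. x < X \<omega>}) \<partial>lborel)"
proof -
  interpret pair_sigma_finite M lborel ..
  \<comment> \<open>Any relation \<open>R\<close> between \<open><\<close> and \<open>\<le>\<close>
    gives the same integral, since for fixed \<open>\<omega>\<close> they differ only at the single
    point \<open>x = X \<omega>\<close>.\<close>
  have gen: "(\<integral>\<^sup>+\<omega>. ennreal (X \<omega> powr a) \<partial>M)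
      = (\<integral>\<^sup>+x. ennreal (a * x powr (a - 1)) * indicator {0<..} x * ennreal (prob {\<omega> \<in> space M. R x (X \<omega>)}) \<partial>lborel)"
    if R[measurable]: "Measurable.pred (borel \<Otimes>\<^sub>M borel) (\<lambda>(x, y). R x y)"
      and R1: "\<And>x y. x < y \<Longrightarrow> R x y" and R2: "\<And>x y. R x y \<Longrightarrow> x \<le> y" for R :: "real \<Rightarrow> real \<Rightarrow> bool"
  proof -
    have "(\<integral>\<^sup>+\<omega>. ennreal (X \<omega> powr a) \<partial>M) = (\<integral>\<^sup>+\<omega>. \<integral>\<^sup>+x. ennreal (a * x powr (a - 1)) * indicator {0<..} x * of_bool (R x (X \<omega>)) \<partial>lborel \<partial>M)"
    proof (rule nn_integral_cong)
      fix \<omega> assume "\<omega> \<in> space M"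
      then have "ennreal (X \<omega> powr a) = (\<integral>\<^sup>+x. ennreal (a * x powr (a - 1)) * indicator {0..X \<omega>} x \<partial>lborel)"
        using nn_integral_powr_Icc[OF a nn] by simp
      also have "\<dots> = (\<integral>\<^sup>+x. ennreal (a * x powr (a - 1)) * indicator {0<..} x * of_bool (R x (X \<omega>)) \<partial>lborel)"
      proof (rule nn_integral_cong_AE)
        have "AE x in lborel. x \<noteq> 0 \<and> x \<noteq> X \<omega>" by (simp add: AE_lborel_singleton)
        then show "AE x in lborel. ennreal (a * x powr (a - 1)) * indicator {0..X \<omega>} x = ennreal (a * x powr (a - 1)) * indicator {0<..} x * of_bool (R x (X \<omega>))"
          by eventually_elim (use R1 R2 in \<open>fastforce simp: indicator_def less_le\<close>)
      qed
      finally show "ennreal (X \<omega> powr a) = (\<integral>\<^sup>+x. ennreal (a * x powr (a - 1)) * indicator {0<..} x * of_bool (R x (X \<omega>)) \<partial>lborel)" .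
    qed
    also have "\<dots> = (\<integral>\<^sup>+x. \<integral>\<^sup>+\<omega>. ennreal (a * x powr (a - 1)) * indicator {0<..} x * of_bool (R x (X \<omega>)) \<partial>M \<partial>lborel)"
      by (rule Fubini'[symmetric]) (simp add: split_beta)
    also have "\<dots> = (\<integral>\<^sup>+x. ennreal (a * x powr (a - 1)) * indicator {0<..} x * ennreal (prob {\<omega> \<in> space M. R x (X \<omega>)}) \<partial>lborel)"
    proof (rule nn_integral_cong)
      fix x :: real
      have [measurable]: "{\<omega> \<in> space M. R x (X \<omega>)} \<in> events" by measurable
      have "(\<integral>\<^sup>+\<omega>. ennreal (a * x powr (a - 1)) * indicator {0<..} x * of_bool (R x (X \<omega>)) \<partial>M)
          = ennreal (a * x powr (a - 1)) * indicator {0<..} x * (\<integral>\<^sup>+\<omega>. of_bool (R x (X \<omega>)) \<partial>M)"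
        by (rule nn_integral_cmult) simp
      also have "(\<integral>\<^sup>+\<omega>. of_bool (R x (X \<omega>)) \<partial>M) = (\<integral>\<^sup>+\<omega>. indicator {\<omega> \<in> space M. R x (X \<omega>)} \<omega> \<partial>M)"
        by (rule nn_integral_cong) (auto simp: indicator_def)
      also have "\<dots> = ennreal (prob {\<omega> \<in> space M. R x (X \<omega>)})" by (simp add: emeasure_eq_measure)
      finally show "(\<integral>\<^sup>+\<omega>. ennreal (a * x powr (a - 1)) * indicator {0<..} x * of_bool (R x (X \<omega>)) \<partial>M)
          = ennreal (a * x powr (a - 1)) * indicator {0<..} x * ennreal (prob {\<omega> \<in> space M. R x (X \<omega>)})" .
    qed
    finally show ?thesis .
  qed
  show "(\<integral>\<^sup>+\<omega>. ennreal (X \<omega> powr a) \<partial>M)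
      = (\<integral>\<^sup>+x. ennreal (a * x powr (a - 1)) * indicator {0<..} x * ennreal (prob {\<omega> \<in> space M. x \<le> X \<omega>}) \<partial>lborel)"
  proof (rule gen)
    show "Measurable.pred (borel \<Otimes>\<^sub>M borel) (\<lambda>(x, y). x \<le> (y :: real))"
      unfolding split_beta' by measurable
  qed auto
  show "(\<integral>\<^sup>+\<omega>. ennreal (X \<omega> powr a) \<partial>M)
      = (\<integral>\<^sup>+x. ennreal (a * x powr (a - 1)) * indicator {0<..} x * ennreal (prob {\<omega> \<in> space M. x < X \<omega>}) \<partial>lborel)"
  proof (rule gen)
    show "Measurable.pred (borel \<Otimes>\<^sub>M borel) (\<lambda>(x, y). x < (y :: real))"
      unfolding split_beta' by measurable
  qed auto
qed

end

section \<open>Uniqueness of Laplace transforms and independent random times\<close>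

text \<open>On \<open>[-1, 1]\<close> all absolute moments are at most 1, so the Taylor polynomials
  of the characteristic function, which depend on moments only, have error at most
  \<open>2 * \<bar>t\<bar> ^ n / fact n\<close>. Equal moments thus force equal characteristic
  functions.\<close>

lemma real_distribution_moments_unique:
  assumes "real_distribution M1" "real_distribution M2"
    and b1: "AE x in M1. \<bar>x\<bar> \<le> 1" and b2: "AE x in M2. \<bar>x\<bar> \<le> 1"
    and eq: "\<And>k. (\<integral>x. x ^ k \<partial>M1) = (\<integral>x. x ^ k \<partial>M2)"
  shows "M1 = M2"
proof (rule Levy_uniqueness[OF assms(1,2)], rule ext)
  fix t :: real
  have bound: "cmod (char M t - (\<Sum>k\<le>n. ((\<i> * t)^k / fact k) * (\<integral>x. x ^ k \<partial>M))) \<le> 2 * (\<bar>t\<bar> ^ n / fact n)"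
    if M: "real_distribution M" and b: "AE x in M. \<bar>x\<bar> \<le> 1" for M :: "real measure" and n
  proof -
    interpret real_distribution M by (rule M)
    have b': "AE x in M. norm (\<bar>x\<bar> ^ k) \<le> 1" for k :: nat
      using b by eventually_elim (simp add: power_le_one)
    have int: "integrable M (\<lambda>x. x ^ k)" for k :: nat
      by (rule integrable_const_bound[where B=1]) (use b'[of k] in \<open>simp_all add: power_abs\<close>)
    have inta: "integrable M (\<lambda>x. \<bar>x\<bar> ^ k)" for k :: nat
      by (rule integrable_const_bound[where B=1]) (use b'[of k] in simp_all)
    have "expectation (\<lambda>x. \<bar>x\<bar> ^ n) \<le> expectation (\<lambda>x. 1)"
      by (rule integral_mono_AE[OF inta]) (use b'[of n] in simp_all)
    then have "expectation (\<lambda>x. \<bar>x\<bar> ^ n) \<le> 1" by (simp add: prob_space[unfolded space_eq_univ])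
    then have "(2 * \<bar>t\<bar> ^ n / fact n) * expectation (\<lambda>x. \<bar>x\<bar> ^ n) \<le> (2 * \<bar>t\<bar> ^ n / fact n) * 1"
      by (intro mult_left_mono) auto
    with char_approx1[of n t, OF int] show ?thesis by (simp add: mult.assoc)
  qed
  have "cmod (char M1 t - char M2 t) \<le> 4 * (\<bar>t\<bar> ^ n / fact n)" for n
    using bound[OF assms(1) b1, of n] bound[OF assms(2) b2, of n, folded eq]
      norm_triangle_ineq4[of "char M1 t - (\<Sum>k\<le>n. ((\<i> * t)^k / fact k) * (\<integral>x. x ^ k \<partial>M1))"
        "char M2 t - (\<Sum>k\<le>n. ((\<i> * t)^k / fact k) * (\<integral>x. x ^ k \<partial>M1))"]
    by simp
  moreover have "(\<lambda>n. 4 * (\<bar>t\<bar> ^ n / fact n)) \<longlonglongrightarrow> 4 * 0"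
    by (intro tendsto_mult tendsto_const) (use summable_LIMSEQ_zero[OF summable_exp[of "\<bar>t\<bar>"]] in \<open>simp add: field_simps\<close>)
  ultimately have "cmod (char M1 t - char M2 t) \<le> 0"
    by (intro LIMSEQ_le_const[where x=0]) auto
  then show "char M1 t = char M2 t" by simp
qed

text \<open>The Laplace transform at the integers lists the moments of \<open>exp (- X)\<close>,
  which lies in \<open>[0, 1]\<close>; the law of \<open>X\<close> is recovered by
  \<open>- ln\<close>.\<close>

lemma (in prob_space) laplace_transform_unique:
  fixes X Y :: "'a \<Rightarrow> real"
  assumes [measurable]: "X \<in> borel_measurable M" "Y \<in> borel_measurable M"
    and nn: "\<And>\<omega>. \<omega> \<in> space M \<Longrightarrow> 0 \<le> X \<omega>" "\<And>\<omega>. \<omega> \<in> space M \<Longrightarrow> 0 \<le> Y \<omega>"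
    and eq: "\<And>n::nat. (\<integral>\<omega>. exp (- real n * X \<omega>) \<partial>M) = (\<integral>\<omega>. exp (- real n * Y \<omega>) \<partial>M)"
  shows "distr M borel X = distr M borel Y"
proof -
  have e: "distr M borel (\<lambda>\<omega>. exp (- X \<omega>)) = distr M borel (\<lambda>\<omega>. exp (- Y \<omega>))"
  proof (rule real_distribution_moments_unique)
    show "real_distribution (distr M borel (\<lambda>\<omega>. exp (- X \<omega>)))" "real_distribution (distr M borel (\<lambda>\<omega>. exp (- Y \<omega>)))"
      by (simp_all add: real_distribution_def real_distribution_axioms_def prob_space_distr)
    show "AE x in distr M borel (\<lambda>\<omega>. exp (- X \<omega>)). \<bar>x\<bar> \<le> 1" "AE x in distr M borel (\<lambda>\<omega>. exp (- Y \<omega>)). \<bar>x\<bar> \<le> 1"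
      by (subst AE_distr_iff, simp, simp, use nn in auto)+
    show "(\<integral>x. x ^ k \<partial>distr M borel (\<lambda>\<omega>. exp (- X \<omega>))) = (\<integral>x. x ^ k \<partial>distr M borel (\<lambda>\<omega>. exp (- Y \<omega>)))" for k
      using eq[of k] by (simp add: integral_distr exp_of_nat_mult[symmetric])
  qed
  have "distr M borel Z = distr (distr M borel (\<lambda>\<omega>. exp (- Z \<omega>))) borel (\<lambda>u. - ln u)"
    if [measurable]: "Z \<in> borel_measurable M" for Z :: "'a \<Rightarrow> real"
    by (subst distr_distr) (auto simp: o_def)
  then show ?thesis using e assms(1,2) by metis
qed

text \<open>Right-continuity makes \<open>(s, \<omega>) \<mapsto> Q s \<omega>\<close> jointly measurable, so that Fubini's theorem applies to
  the law of the pair \<open>(\<omega>, \<tau> \<omega>)\<close>.\<close>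

lemma (in prob_space) prob_at_independent_time:
  fixes F G :: "'a measure" and Q :: "real \<Rightarrow> 'a \<Rightarrow> bool" and \<tau> :: "'a \<Rightarrow> real"
  assumes sp: "space F = space M" "space G = space M"
    and ind: "indep_set (sets F) (sets G)"
    and Q: "\<And>s. 0 \<le> s \<Longrightarrow> Measurable.pred F (Q s)"
    and rc: "\<And>\<omega> s. \<omega> \<in> space M \<Longrightarrow> 0 \<le> s \<Longrightarrow> \<forall>\<^sub>F u in at_right s. Q u \<omega> = Q s \<omega>"
    and \<tau>[measurable]: "\<tau> \<in> borel_measurable G" and \<tau>0: "\<And>\<omega>. \<omega> \<in> space M \<Longrightarrow> 0 \<le> \<tau> \<omega>"
    and A[measurable]: "A \<in> sets G"
  shows "{\<omega> \<in> A. Q (\<tau> \<omega>) \<omega>} \<in> sigma_sets (space M) (sets F \<union> sets G)"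
    and "ennreal (prob {\<omega> \<in> A. Q (\<tau> \<omega>) \<omega>}) = (\<integral>\<^sup>+\<omega>. ennreal (prob {x \<in> space M. Q (\<tau> \<omega>) x}) * indicator A \<omega> \<partial>M)"
proof -
  have FG: "sets F \<subseteq> events" "sets G \<subseteq> events"
    using ind unfolding indep_set_def indep_sets_def by (auto split: bool.splits)
  have idF: "(\<lambda>\<omega>. \<omega>) \<in> measurable M F" and idG: "(\<lambda>\<omega>. \<omega>) \<in> measurable M G"
    using FG sp by (auto simp: measurable_def)
  \<comment> \<open>\<open>Q' m\<close> replaces \<open>\<tau>\<close> by the grid point of mesh
    \<open>1 / (m + 1)\<close> strictly to its right. Only countably many times occur, hence
    measurability, and approximation from the right makes \<open>Q' m\<close> eventually equal to
    \<open>Q\<close> at \<open>\<tau>\<close>.\<close>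
  define Q' where "Q' m z \<longleftrightarrow> (\<exists>i::nat. nat \<lfloor>\<tau> (snd z) * (real m + 1)\<rfloor> = i \<and> Q ((real i + 1) / (real m + 1)) (fst z))"
    for m :: nat and z :: "'a \<times> 'a"
  have Q'[measurable]: "Measurable.pred (F \<Otimes>\<^sub>M G) (Q' m)" for m
  proof -
    have [measurable]: "Measurable.pred F (Q ((real i + 1) / (real m + 1)))" for i :: nat by (rule Q) simp
    show ?thesis unfolding Q'_def by measurable
  qed
  have lim: "Q (\<tau> (snd z)) (fst z) \<longleftrightarrow> (\<exists>k. \<forall>m\<ge>k. Q' m z)" if z: "fst z \<in> space M" "snd z \<in> space M" for z
  proof -
    define s where "s = \<tau> (snd z)"
    have s: "0 \<le> s" using \<tau>0 z by (simp add: s_def)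
    from rc[OF z(1) s] obtain b where b: "s < b" "\<And>u. s < u \<Longrightarrow> u < b \<Longrightarrow> Q u (fst z) = Q s (fst z)"
      by (auto simp: eventually_at_right_field)
    obtain k where k: "1 / (real k + 1) < b - s"
      using reals_Archimedean[of "b - s"] b by (auto simp: inverse_eq_divide add.commute)
    have "Q' m z = Q s (fst z)" if "k \<le> m" for m
    proof -
      define i where "i = nat \<lfloor>s * (real m + 1)\<rfloor>"
      have "0 \<le> s * (real m + 1)" using s by simp
      then have "real i \<le> s * (real m + 1)" "s * (real m + 1) < real i + 1" unfolding i_def by linarith+
      then have "s < (real i + 1) / (real m + 1)" "(real i + 1) / (real m + 1) \<le> s + 1 / (real m + 1)"
        by (simp_all add: add_divide_distrib pos_less_divide_eq pos_divide_le_eq distrib_right flip: add_divide_distrib)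
      moreover have "1 / (real m + 1) \<le> 1 / (real k + 1)" using that by (simp add: frac_le)
      ultimately show ?thesis using b(2)[of "(real i + 1) / (real m + 1)"] k by (simp add: Q'_def s_def[symmetric] i_def[symmetric])
    qed
    then show ?thesis unfolding s_def[symmetric] by (meson max.cobounded1 max.cobounded2 order_refl)
  qed
  define R where "R = {z \<in> space (F \<Otimes>\<^sub>M G). snd z \<in> A \<and> (\<exists>k. \<forall>m\<ge>k. Q' m z)}"
  have R[measurable]: "R \<in> sets (F \<Otimes>\<^sub>M G)" unfolding R_def by measurable
  have ASp: "A \<subseteq> space M" using A sp sets.sets_into_space by metis
  have diag: "{\<omega> \<in> A. Q (\<tau> \<omega>) \<omega>} = (\<lambda>\<omega>. (\<omega>, \<omega>)) -` R \<inter> space M"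
  proof (rule set_eqI)
    fix \<omega>
    show "\<omega> \<in> {\<omega> \<in> A. Q (\<tau> \<omega>) \<omega>} \<longleftrightarrow> \<omega> \<in> (\<lambda>\<omega>. (\<omega>, \<omega>)) -` R \<inter> space M"
    proof (cases "\<omega> \<in> space M")
      case True
      from lim[of "(\<omega>, \<omega>)", unfolded fst_conv snd_conv, OF True True] True show ?thesis
        by (simp only: R_def space_pair_measure sp vimage_eq Int_iff mem_Collect_eq mem_Times_iff fst_conv snd_conv simp_thms)
    qed (use ASp in auto)
  qed
  \<comment> \<open>The diagonal map is measurable from the sigma-algebra generated by
    \<open>F\<close> and \<open>G\<close> together, which locates the event more precisely than in
    \<open>events\<close>. This is what independence of the index \<open>J\<close> will
    require.\<close>
  show "{\<omega> \<in> A. Q (\<tau> \<omega>) \<omega>} \<in> sigma_sets (space M) (sets F \<union> sets G)"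
  proof -
    let ?S = "sigma (space M) (sets F \<union> sets G)"
    have sub: "sets F \<union> sets G \<subseteq> Pow (space M)" using sp sets.space_closed by (metis Un_least)
    then have "(\<lambda>\<omega>. \<omega>) \<in> measurable ?S F" "(\<lambda>\<omega>. \<omega>) \<in> measurable ?S G"
      using sp by (auto simp: measurable_def Int_absorb2 sets.sets_into_space)
    then have "(\<lambda>\<omega>. (\<omega>, \<omega>)) \<in> measurable ?S (F \<Otimes>\<^sub>M G)" by measurable
    from measurable_sets[OF this R] show ?thesis unfolding diag using sub by simp
  qed
  \<comment> \<open>Independence of the sub-sigma-algebras is restated for the identity map seen as
    a random variable into \<open>F\<close> and into \<open>G\<close>. The law of the diagonal map
    is then the product of the two restrictions of \<open>M\<close>.\<close>
  have iv: "indep_var F (\<lambda>\<omega>. \<omega>) G (\<lambda>\<omega>. \<omega>)"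
  proof -
    have *: "{(\<lambda>\<omega>. \<omega>) -` B \<inter> space M |B. B \<in> sets H} = sets H" if "space H = space M" for H :: "'a measure"
    proof -
      have "(\<lambda>\<omega>. \<omega>) -` B \<inter> space M = B" if "B \<in> sets H" for B
        using sets.sets_into_space[OF that] \<open>space H = space M\<close> by auto
      then have "{(\<lambda>\<omega>. \<omega>) -` B \<inter> space M |B. B \<in> sets H} = {B |B. B \<in> sets H}" by metis
      then show ?thesis by simp
    qed
    have "sigma_sets (space M) (sets F) = sets F" "sigma_sets (space M) (sets G) = sets G"
      using sets.sigma_sets_eq[of F] sets.sigma_sets_eq[of G] by (simp_all add: sp)
    then show ?thesis unfolding indep_var_eq *[OF sp(1)] *[OF sp(2)] using idF idG ind by simp
  qed
  let ?F = "distr M F (\<lambda>\<omega>. \<omega>)" and ?G = "distr M G (\<lambda>\<omega>. \<omega>)"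
  interpret F: prob_space ?F by (rule prob_space_distr[OF idF])
  interpret G: prob_space ?G by (rule prob_space_distr[OF idG])
  interpret FG: pair_prob_space ?F ?G ..
  have pairm: "(\<lambda>\<omega>. (\<omega>, \<omega>)) \<in> measurable M (F \<Otimes>\<^sub>M G)" using idF idG by measurable
  have "ennreal (prob {\<omega> \<in> A. Q (\<tau> \<omega>) \<omega>}) = emeasure (distr M (F \<Otimes>\<^sub>M G) (\<lambda>\<omega>. (\<omega>, \<omega>))) R"
    by (subst emeasure_distr[OF pairm R]) (simp add: diag emeasure_eq_measure)
  also have "\<dots> = emeasure (?F \<Otimes>\<^sub>M ?G) R" using iv by (simp add: indep_var_distribution_eq)
  also have "\<dots> = (\<integral>\<^sup>+y. emeasure ?F ((\<lambda>x. (x, y)) -` R) \<partial>?G)"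
  proof (rule FG.emeasure_pair_measure_alt2)
    have "sets (?F \<Otimes>\<^sub>M ?G) = sets (F \<Otimes>\<^sub>M G)" by (rule sets_pair_measure_cong) auto
    then show "R \<in> sets (?F \<Otimes>\<^sub>M ?G)" using R by simp
  qed
  also have "\<dots> = (\<integral>\<^sup>+y. emeasure ?F ((\<lambda>x. (x, y)) -` R) \<partial>M)"
  proof -
    have "sets (?F \<Otimes>\<^sub>M ?G) = sets (F \<Otimes>\<^sub>M G)" by (rule sets_pair_measure_cong) auto
    then have "R \<in> sets (?F \<Otimes>\<^sub>M ?G)" using R by simp
    from FG.measurable_emeasure_Pair2[OF this]
    have "(\<lambda>y. emeasure ?F ((\<lambda>x. (x, y)) -` R)) \<in> borel_measurable G" by simp
    then show ?thesis by (subst nn_integral_distr[OF idG]) simp_all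
  qed
  also have "\<dots> = (\<integral>\<^sup>+\<omega>. ennreal (prob {x \<in> space M. Q (\<tau> \<omega>) x}) * indicator A \<omega> \<partial>M)"
  proof (rule nn_integral_cong)
    fix y assume y: "y \<in> space M"
    have ms: "(\<lambda>x. (x, y)) -` R \<in> sets F" by (rule sets_Pair2[OF R])
    have "emeasure ?F ((\<lambda>x. (x, y)) -` R) = emeasure M ((\<lambda>x. (x, y)) -` R \<inter> space M)"
      using emeasure_distr[OF idF ms] by simp
    also have "(\<lambda>x. (x, y)) -` R \<inter> space M = (if y \<in> A then {x \<in> space M. Q (\<tau> y) x} else {})"
    proof (rule set_eqI)
      fix x
      show "x \<in> (\<lambda>x. (x, y)) -` R \<inter> space M \<longleftrightarrow> x \<in> (if y \<in> A then {x \<in> space M. Q (\<tau> y) x} else {})"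
      proof (cases "x \<in> space M")
        case True
        have "(x, y) \<in> R \<longleftrightarrow> y \<in> A \<and> (\<exists>k. \<forall>m\<ge>k. Q' m (x, y))"
          unfolding R_def mem_Collect_eq fst_conv snd_conv space_pair_measure sp mem_Times_iff using True y by (simp only: simp_thms)
        also have "\<dots> \<longleftrightarrow> y \<in> A \<and> Q (\<tau> y) x"
          using lim[of "(x, y)", unfolded fst_conv snd_conv, OF True y] by (simp only:)
        finally show ?thesis using True by (simp only: vimage_eq Int_iff) (simp split: if_split)
      qed simp
    qed
    finally show "emeasure ?F ((\<lambda>x. (x, y)) -` R) = ennreal (prob {x \<in> space M. Q (\<tau> y) x}) * indicator A y"
      by (simp add: emeasure_eq_measure)
  qed
  finally show "ennreal (prob {\<omega> \<in> A. Q (\<tau> \<omega>) \<omega>}) = (\<integral>\<^sup>+\<omega>. ennreal (prob {x \<in> space M. Q (\<tau> \<omega>) x}) * indicator A \<omega> \<partial>M)" .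
qed

section \<open>Inverse of a stable subordinator\<close>

text \<open>Carries the sigma-algebra \<open>process_events P X\<close> as a measure space, so that
  measurability with respect to the process alone can be expressed by
  \<open>measurable\<close>.\<close>

definition process_measure :: "'a measure \<Rightarrow> (real \<Rightarrow> 'a \<Rightarrow> 'b::topological_space) \<Rightarrow> 'a measure" where
  "process_measure P X = sigma (space P) {X t -` A \<inter> space P | t A. 0 \<le> t \<and> A \<in> sets borel}"

lemma space_process_measure[simp]: "space (process_measure P X) = space P"
  and sets_process_measure[simp]: "sets (process_measure P X) = process_events P X"
  unfolding process_measure_def process_events_def by (subst space_measure_of sets_measure_of; auto)+

lemma measurable_process_measure:
  "0 \<le> t \<Longrightarrow> X t \<in> borel_measurable (process_measure P X)"
  by (rule measurableI) (auto simp: process_events_def intro!: sigma_sets.Basic)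

lemma measurable_process_measure_nat:
  fixes X :: "real \<Rightarrow> 'a \<Rightarrow> nat"
  shows "0 \<le> t \<Longrightarrow> X t \<in> measurable (process_measure P X) (count_space UNIV)"
  using measurable_process_measure[of t X P] by (simp add: measurable_cong_sets[OF refl sets_borel_eq_count_space])

lemma process_events_subset:
  assumes "\<And>t. 0 \<le> t \<Longrightarrow> X t \<in> borel_measurable P"
  shows "process_events P X \<subseteq> sets P"
  unfolding process_events_def using assms by (intro sets.sigma_sets_subset) (auto intro: measurable_sets)

text \<open>In a discrete space, convergence means being eventually constant. This is the form of
  right-continuity needed for evaluation at random times.\<close>

lemma nat_path_eventually_const:
  fixes n :: "real \<Rightarrow> nat"
  assumes "increasing_rc_path n" "0 \<le> s"
  shows "\<forall>\<^sub>F u in at_right s. n u = n s"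
proof -
  have "(n \<longlongrightarrow> n s) (at_right s)"
    using assms by (auto simp: increasing_rc_path_def continuous_within)
  then show ?thesis by (simp add: tendsto_discrete)
qed

section \<open>Pathwise properties of the inverse process\<close>

lemma inverse_process_nonneg: "0 \<le> inverse_process D t \<omega>"
  unfolding inverse_process_def by (auto intro!: cInf_greatest)

lemma inverse_process_le:
  "0 \<le> s \<Longrightarrow> t < D s \<omega> \<Longrightarrow> inverse_process D t \<omega> \<le> s"
  unfolding inverse_process_def by (auto intro!: cInf_lower bdd_belowI[of _ 0])

text \<open>By monotonicity every level that \<open>D\<close> needs to exceed \<open>t\<close> lies
  at or beyond \<open>s\<close>. The existence hypothesis excludes the default value 0.\<close>

lemma inverse_process_ge:
  assumes "increasing_rc_path (\<lambda>s. D s \<omega>)" "0 \<le> s" "D s \<omega> \<le> t" "\<exists>s\<ge>0. t < D s \<omega>"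
  shows "s \<le> inverse_process D t \<omega>"
proof -
  have "s \<le> u" if "0 \<le> u" "t < D u \<omega>" for u
  proof (rule ccontr)
    assume "\<not> s \<le> u"
    then have "D u \<omega> \<le> D s \<omega>" using assms(1) that \<open>0 \<le> s\<close>
      by (auto simp: increasing_rc_path_def mono_on_def)
    then show False using that assms(3) by simp
  qed
  then show ?thesis unfolding inverse_process_def using assms(4) by (auto intro!: cInf_greatest)
qed

text \<open>A countable description, from which measurability follows: monotone paths allow a
  rational between the crossing level and \<open>x\<close>. The second disjunct is the default value
  0, which is below the positive \<open>x\<close>.\<close>

lemma inverse_process_less_iff:
  assumes path: "increasing_rc_path (\<lambda>s. D s \<omega>)" and x: "0 < x"
  shows "inverse_process D t \<omega> < x \<longleftrightarrow>
    (\<exists>q::rat. 0 \<le> q \<and> real_of_rat q < x \<and> t < D (real_of_rat q) \<omega>) \<or> \<not> (\<exists>n::nat. t < D (real n) \<omega>)"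
proof (cases "\<exists>s\<ge>0. t < D s \<omega>")
  case True
  have mono: "t < D v \<omega>" if "0 \<le> u" "u \<le> v" "t < D u \<omega>" for u v
    using path that by (auto simp: increasing_rc_path_def mono_on_def intro: less_le_trans)
  from True obtain s0 where s0: "0 \<le> s0" "t < D s0 \<omega>" by blast
  obtain n0 :: nat where "s0 \<le> real n0" using real_arch_simple by blast
  then have n: "\<exists>n::nat. t < D (real n) \<omega>" using mono[of s0 "real n0"] s0 by auto
  have "inverse_process D t \<omega> < x \<longleftrightarrow> (\<exists>s\<ge>0. t < D s \<omega> \<and> s < x)"
    using True unfolding inverse_process_def by (subst if_P, simp, subst cInf_less_iff) (auto intro!: bdd_belowI[of _ 0])
  also have "\<dots> \<longleftrightarrow> (\<exists>q::rat. 0 \<le> q \<and> real_of_rat q < x \<and> t < D (real_of_rat q) \<omega>)"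
  proof safe
    fix s assume s: "0 \<le> s" "t < D s \<omega>" "s < x"
    then obtain q where "q \<in> \<rat>" and q: "s < q" "q < x" using Rats_dense_in_real by blast
    then obtain q' where "q = real_of_rat q'" by (auto elim: Rats_cases)
    moreover from this have "0 \<le> real_of_rat q'" using q s by linarith
    ultimately show "\<exists>q::rat. 0 \<le> q \<and> real_of_rat q < x \<and> t < D (real_of_rat q) \<omega>"
      using q s mono[of s q] by (intro exI[of _ q']) (auto simp: zero_le_of_rat_iff)
  next
    fix q :: rat assume "0 \<le> q" "real_of_rat q < x" "t < D (real_of_rat q) \<omega>"
    then show "\<exists>s\<ge>0. t < D s \<omega> \<and> s < x" by (intro exI[of _ "real_of_rat q"]) auto
  qed
  finally show ?thesis using n by blast
next
  case False
  then have "\<not> (\<exists>n::nat. t < D (real n) \<omega>)" by auto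
  moreover have "inverse_process D t \<omega> = 0" unfolding inverse_process_def by (simp only: False if_False)
  ultimately show ?thesis using x by simp
qed

text \<open>Measurability with respect to \<open>D\<close> alone, so that independence of
  \<open>D\<close> and the Poisson process passes to the inverse.\<close>

lemma inverse_process_measurable:
  assumes path: "\<And>\<omega>. \<omega> \<in> space P \<Longrightarrow> increasing_rc_path (\<lambda>s. D s \<omega>)"
  shows "inverse_process D t \<in> borel_measurable (process_measure P D)"
proof (rule borel_measurable_iff_less[THEN iffD2], rule allI)
  fix x :: real
  let ?G = "process_measure P D"
  have p2: "Measurable.pred ?G (\<lambda>\<omega>. t < D (real n) \<omega>)" for n :: nat
  proof -
    have [measurable]: "D (real n) \<in> borel_measurable ?G" by (rule measurable_process_measure) simp
    show ?thesis by measurable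
  qed
  have p1: "Measurable.pred ?G (\<lambda>\<omega>. 0 \<le> q \<and> real_of_rat q < x \<and> t < D (real_of_rat q) \<omega>)" for q :: rat
  proof (cases "0 \<le> q")
    case True
    then have [measurable]: "D (real_of_rat q) \<in> borel_measurable ?G" by (intro measurable_process_measure) simp
    show ?thesis by measurable
  qed simp
  show "{\<omega> \<in> space ?G. inverse_process D t \<omega> < x} \<in> sets ?G"
  proof (cases "0 < x")
    case True
    have "Measurable.pred ?G (\<lambda>\<omega>. (\<exists>q::rat. 0 \<le> q \<and> real_of_rat q < x \<and> t < D (real_of_rat q) \<omega>) \<or> \<not> (\<exists>n::nat. t < D (real n) \<omega>))"
      by (intro p1 p2 pred_intros_logic pred_intros_countable)
    moreover have "{\<omega> \<in> space ?G. inverse_process D t \<omega> < x}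
        = {\<omega> \<in> space ?G. (\<exists>q::rat. 0 \<le> q \<and> real_of_rat q < x \<and> t < D (real_of_rat q) \<omega>) \<or> \<not> (\<exists>n::nat. t < D (real n) \<omega>)}"
      by (intro Collect_cong conj_cong refl inverse_process_less_iff[OF path True]) simp
    ultimately show ?thesis by (simp only: pred_def)
  next
    case False
    then have "{\<omega> \<in> space ?G. inverse_process D t \<omega> < x} = {}"
      using inverse_process_nonneg[of D t] by (auto simp: not_less intro: order_trans)
    then show ?thesis by (metis sets.empty_sets)
  qed
qed

text \<open>The inverse is right-continuous: choose \<open>x\<close> with \<open>s < D x\<close>
  just beyond the inverse at \<open>s\<close>; for \<open>u\<close> between \<open>s\<close> and
  \<open>D x\<close> the inverse at \<open>u\<close> lies between the inverse at \<open>s\<close>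
  and \<open>x\<close>. If \<open>D\<close> never exceeds \<open>s\<close>, it exceeds no later
  level either, and both values are the default 0.\<close>

lemma time_changed_path_eventually_const:
  fixes n :: "real \<Rightarrow> nat"
  assumes n: "increasing_rc_path n" and d: "increasing_rc_path (\<lambda>s. D s \<omega>)"
  shows "\<forall>\<^sub>F u in at_right s. n (inverse_process D u \<omega>) = n (inverse_process D s \<omega>)"
proof (cases "\<exists>x\<ge>0. s < D x \<omega>")
  case True
  define e where "e = inverse_process D s \<omega>"
  have e: "0 \<le> e" by (simp add: e_def inverse_process_nonneg)
  from nat_path_eventually_const[OF n e] obtain b where b: "e < b" "\<And>u. e < u \<Longrightarrow> u < b \<Longrightarrow> n u = n e"
    by (auto simp: eventually_at_right_field)
  have "\<exists>x\<ge>0. s < D x \<omega> \<and> x < b"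
  proof (rule ccontr)
    assume "\<not> ?thesis"
    then have "b \<le> e" using True unfolding e_def inverse_process_def by (auto intro!: cInf_greatest)
    then show False using b by simp
  qed
  then obtain x where x: "0 \<le> x" "s < D x \<omega>" "x < b" by blast
  have "n (inverse_process D u \<omega>) = n e" if u: "s < u" "u < D x \<omega>" for u
  proof -
    have "inverse_process D u \<omega> \<le> x" using u x by (intro inverse_process_le) auto
    moreover have "e \<le> inverse_process D u \<omega>"
      using True u x unfolding e_def inverse_process_def
      by (auto intro!: cInf_superset_mono bdd_belowI[of _ 0])
    ultimately show ?thesis using b x by (cases "inverse_process D u \<omega> = e") auto
  qed
  then show ?thesis using x(2) by (auto simp: eventually_at_right_field e_def)
next
  case False
  have "n (inverse_process D u \<omega>) = n (inverse_process D s \<omega>)" if "s < u" for u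
  proof -
    have "\<not> (\<exists>x\<ge>0. u < D x \<omega>)" using False that by (meson less_trans)
    then show ?thesis unfolding inverse_process_def by (simp only: False if_False)
  qed
  then show ?thesis by (auto simp: eventually_at_right_field intro: gt_ex)
qed

section \<open>Law of the stable subordinator and moments of its inverse\<close>

locale stable_subordinator_space = prob_space +
  fixes b :: real and D :: "real \<Rightarrow> 'a \<Rightarrow> real"
  assumes b: "0 < b" "b < 1" and D: "stable_subordinator M b D"
begin

lemma D_measurable: "0 \<le> s \<Longrightarrow> D s \<in> borel_measurable M"
  and D_path: "\<omega> \<in> space M \<Longrightarrow> increasing_rc_path (\<lambda>s. D s \<omega>)"
  using D unfolding stable_subordinator_def subordinator_def by auto

lemma D_nonneg: "\<omega> \<in> space M \<Longrightarrow> 0 \<le> s \<Longrightarrow> 0 \<le> D s \<omega>"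
  using D_path[of \<omega>] by (auto simp: increasing_rc_path_def mono_on_def) (metis order_refl)

lemma laplace_D:
  assumes "0 \<le> s" "0 < \<theta>"
  shows "(\<integral>\<omega>. exp (- \<theta> * D s \<omega>) \<partial>M) = exp (- s * \<theta> powr b)"
  using D assms integral_stable_levy_exponent[OF b assms(2)]
  unfolding stable_subordinator_def subordinator_def by simp

text \<open>Exponential Markov inequality. Letting \<open>\<theta>\<close> grow with
  \<open>x = 0\<close> gives positivity of \<open>D s\<close>; letting \<open>s\<close> grow with
  \<open>\<theta> = 1\<close> gives unboundedness of the paths.\<close>

lemma prob_D_le:
  assumes "0 \<le> s" "0 < \<theta>"
  shows "prob {\<omega> \<in> space M. D s \<omega> \<le> x} \<le> exp (\<theta> * x - s * \<theta> powr b)"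
proof -
  have [measurable]: "D s \<in> borel_measurable M" using assms by (intro D_measurable)
  have int: "integrable M (\<lambda>\<omega>. exp (- \<theta> * D s \<omega>))"
    by (rule integrable_const_bound[where B=1]) (use D_nonneg assms in auto)
  have "prob {\<omega> \<in> space M. D s \<omega> \<le> x} = (\<integral>\<omega>. indicator {\<omega> \<in> space M. D s \<omega> \<le> x} \<omega> \<partial>M)" by simp
  also have "\<dots> \<le> (\<integral>\<omega>. exp (\<theta> * x) * exp (- \<theta> * D s \<omega>) \<partial>M)"
  proof (rule integral_mono)
    show "integrable M (\<lambda>\<omega>. exp (\<theta> * x) * exp (- \<theta> * D s \<omega>))" using int by simp
    show "integrable M (\<lambda>\<omega>. indicator {\<omega> \<in> space M. D s \<omega> \<le> x} \<omega> :: real)"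
      by (rule integrable_real_indicator) (auto simp: emeasure_eq_measure)
    show "indicator {\<omega> \<in> space M. D s \<omega> \<le> x} \<omega> \<le> exp (\<theta> * x) * exp (- \<theta> * D s \<omega>)" for \<omega>
      using assms by (auto simp: indicator_def mult_exp_exp)
  qed
  also have "\<dots> = exp (\<theta> * x) * exp (- s * \<theta> powr b)" using laplace_D[OF assms] by simp
  finally show ?thesis by (simp add: mult_exp_exp)
qed

lemma AE_D_pos:
  assumes "0 < s"
  shows "AE \<omega> in M. 0 < D s \<omega>"
proof -
  have [measurable]: "D s \<in> borel_measurable M" using assms by (intro D_measurable) simp
  have "(\<lambda>n. exp (- s * real n powr b)) \<longlonglongrightarrow> 0"
    using assms b by real_asymp
  moreover have "\<forall>\<^sub>F n in sequentially. prob {\<omega> \<in> space M. D s \<omega> \<le> 0} \<le> exp (- s * real n powr b)"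
    using eventually_gt_at_top[of 0] by eventually_elim (use prob_D_le[of s _ 0] assms in force)
  ultimately have "prob {\<omega> \<in> space M. D s \<omega> \<le> 0} \<le> 0" by (intro tendsto_lowerbound) auto
  then have "prob {\<omega> \<in> space M. D s \<omega> \<le> 0} = 0" by (simp add: measure_le_0_iff)
  then have "AE \<omega> in M. \<not> D s \<omega> \<le> 0" by (subst (asm) prob_eq_0) auto
  then show ?thesis by (auto simp: not_le)
qed

lemma AE_D_unbounded: "AE \<omega> in M. \<exists>s\<ge>0. x < D s \<omega>"
proof -
  have [measurable]: "D (real n) \<in> borel_measurable M" for n by (intro D_measurable) simp
  have "prob {\<omega> \<in> space M. \<forall>n::nat. D (real n) \<omega> \<le> x} \<le> exp (x - real n)" for n :: nat
  proof -
    have "prob {\<omega> \<in> space M. \<forall>n::nat. D (real n) \<omega> \<le> x} \<le> prob {\<omega> \<in> space M. D (real n) \<omega> \<le> x}"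
      by (rule finite_measure_mono) auto
    then show ?thesis using prob_D_le[of "real n" 1 x] by simp
  qed
  moreover have "(\<lambda>n. exp (x - real n)) \<longlonglongrightarrow> 0" by real_asymp
  ultimately have "prob {\<omega> \<in> space M. \<forall>n::nat. D (real n) \<omega> \<le> x} \<le> 0" by (intro LIMSEQ_le_const) auto
  then have "prob {\<omega> \<in> space M. \<forall>n::nat. D (real n) \<omega> \<le> x} = 0" by (simp add: measure_le_0_iff)
  then have "AE \<omega> in M. \<not> (\<forall>n::nat. D (real n) \<omega> \<le> x)" by (subst (asm) prob_eq_0) auto
  then show ?thesis by eventually_elim (metis not_le of_nat_0_le_iff)
qed

text \<open>Both variables have Laplace transform \<open>exp (- s * n powr b)\<close> at
  \<open>n\<close>, since \<open>(n * s powr (1 / b)) powr b = s * n powr b\<close>.\<close>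

lemma D_self_similar:
  assumes "0 < s"
  shows "distr M borel (D s) = distr M borel (\<lambda>\<omega>. s powr (1 / b) * D 1 \<omega>)"
proof (rule laplace_transform_unique)
  show "D s \<in> borel_measurable M" "(\<lambda>\<omega>. s powr (1 / b) * D 1 \<omega>) \<in> borel_measurable M"
    using assms D_measurable by auto
  show "0 \<le> D s \<omega>" "0 \<le> s powr (1 / b) * D 1 \<omega>" if "\<omega> \<in> space M" for \<omega>
    using assms D_nonneg[OF that] by auto
  fix n :: nat
  show "(\<integral>\<omega>. exp (- real n * D s \<omega>) \<partial>M) = (\<integral>\<omega>. exp (- real n * (s powr (1 / b) * D 1 \<omega>)) \<partial>M)"
  proof (cases "n = 0")
    case False
    let ?c = "s powr (1 / b)"
    have "(\<integral>\<omega>. exp (- real n * (?c * D 1 \<omega>)) \<partial>M) = (\<integral>\<omega>. exp (- (real n * ?c) * D 1 \<omega>) \<partial>M)"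
      by (simp add: mult.assoc)
    also have "\<dots> = exp (- 1 * (real n * ?c) powr b)" using False assms by (intro laplace_D) auto
    also have "\<dots> = exp (- s * real n powr b)" using assms b by (simp add: powr_mult powr_powr)
    also have "\<dots> = (\<integral>\<omega>. exp (- real n * D s \<omega>) \<partial>M)" using False assms by (intro laplace_D[symmetric]) auto
    finally show ?thesis by simp
  qed simp
qed

text \<open>Self-similarity, solved for \<open>s\<close>. As \<open>D s \<le> t\<close> is
  essentially the event that the inverse at \<open>t\<close> is at least \<open>s\<close>, this
  compares the tails of the inverse with those of \<open>t powr b * D 1 powr (- b)\<close>.\<close>

lemma prob_D_le_eq:
  assumes s: "0 < s" and t: "0 \<le> t"
  shows "prob {\<omega> \<in> space M. D s \<omega> \<le> t} = prob {\<omega> \<in> space M. s \<le> t powr b * D 1 \<omega> powr (- b)}"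
proof -
  have [measurable]: "D s \<in> borel_measurable M" "D 1 \<in> borel_measurable M"
    using s by (auto intro: D_measurable)
  have "prob {\<omega> \<in> space M. D s \<omega> \<le> t} = measure (distr M borel (D s)) {..t}"
    by (subst measure_distr) (auto intro!: arg_cong[where f=prob])
  also have "\<dots> = prob {\<omega> \<in> space M. s powr (1 / b) * D 1 \<omega> \<le> t}"
    unfolding D_self_similar[OF s] by (subst measure_distr) (auto intro!: arg_cong[where f=prob])
  also have "\<dots> = prob {\<omega> \<in> space M. s \<le> t powr b * D 1 \<omega> powr (- b)}"
  proof (rule prob_eq_AE)
    \<comment> \<open>Only almost everywhere: solving for \<open>s\<close> divides by a power of
      \<open>D 1\<close>, which has to be positive.\<close>
    show "AE \<omega> in M. s powr (1 / b) * D 1 \<omega> \<le> t \<longleftrightarrow> s \<le> t powr b * D 1 \<omega> powr (- b)"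
      using AE_D_pos[of 1, simplified]
    proof eventually_elim
      case (elim \<omega>)
      let ?d = "D 1 \<omega>"
      have "s powr (1 / b) * ?d \<le> t \<longleftrightarrow> (s powr (1 / b) * ?d) powr b \<le> t powr b"
        using elim s t b
        by (metis less_eq_real_def mult_nonneg_nonneg not_le powr_ge_zero powr_less_mono2 powr_mono2)
      also have "\<dots> \<longleftrightarrow> s * ?d powr b \<le> t powr b"
        using elim s b by (simp add: powr_mult powr_powr)
      also have "\<dots> \<longleftrightarrow> s \<le> t powr b * ?d powr (- b)"
        using elim by (simp add: powr_minus field_simps)
      finally show ?case .
    qed
  qed auto
  finally show ?thesis .
qed

text \<open>\<open>Gamma (b * a) * d powr (- (b * a))\<close> is the integral of
  \<open>x powr (b * a - 1) * exp (- d * x)\<close>. Taking expectations under the integral inserts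
  the Laplace transform \<open>exp (- (x powr b))\<close> and leaves \<open>Gamma a / b\<close>; the
  functional equation of Gamma does the rest.\<close>

lemma negative_moment_D:
  assumes "0 < a"
  shows "(\<integral>\<^sup>+\<omega>. ennreal (D 1 \<omega> powr (- (b * a))) \<partial>M) = ennreal (Gamma (a + 1) / Gamma (b * a + 1))"
proof -
  interpret pair_sigma_finite M lborel ..
  let ?L = "lborel :: real measure"
  have [measurable]: "D 1 \<in> borel_measurable M" by (auto intro: D_measurable)
  have ba: "0 < b * a" using b assms by simp
  have "ennreal (Gamma (b * a)) * (\<integral>\<^sup>+\<omega>. ennreal (D 1 \<omega> powr (- (b * a))) \<partial>M) = (\<integral>\<^sup>+\<omega>. ennreal (Gamma (b * a)) * ennreal (D 1 \<omega> powr (- (b * a))) \<partial>M)"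
    by (rule nn_integral_cmult[symmetric]) simp
  also have "\<dots> = (\<integral>\<^sup>+\<omega>. \<integral>\<^sup>+x. ennreal (x powr (b * a - 1) * exp (- D 1 \<omega> * x)) * indicator {0<..} x \<partial>?L \<partial>M)"
  proof (rule nn_integral_cong_AE)
    show "AE \<omega> in M. ennreal (Gamma (b * a)) * ennreal (D 1 \<omega> powr (- (b * a))) = (\<integral>\<^sup>+x. ennreal (x powr (b * a - 1) * exp (- D 1 \<omega> * x)) * indicator {0<..} x \<partial>?L)"
      using AE_D_pos[of 1, simplified] by eventually_elim (simp only: nn_integral_Gamma_scaled[OF ba], simp add: ennreal_mult' ba)
  qed
  also have "\<dots> = (\<integral>\<^sup>+x. \<integral>\<^sup>+\<omega>. ennreal (x powr (b * a - 1) * exp (- D 1 \<omega> * x)) * indicator {0<..} x \<partial>M \<partial>?L)"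
    by (rule Fubini'[symmetric]) (simp add: split_beta)
  also have "\<dots> = (\<integral>\<^sup>+x. ennreal (x powr (b * a - 1) * exp (- (x powr b))) * indicator {0<..} x \<partial>?L)"
  proof (rule nn_integral_cong)
    fix x :: real
    show "(\<integral>\<^sup>+\<omega>. ennreal (x powr (b * a - 1) * exp (- D 1 \<omega> * x)) * indicator {0<..} x \<partial>M) = ennreal (x powr (b * a - 1) * exp (- (x powr b))) * indicator {0<..} x"
    proof (cases "0 < x")
      case True
      have int: "integrable M (\<lambda>\<omega>. exp (- x * D 1 \<omega>))"
        by (rule integrable_const_bound[where B=1]) (use D_nonneg True in auto)
      have "(\<integral>\<^sup>+\<omega>. ennreal (exp (- x * D 1 \<omega>)) \<partial>M) = ennreal (exp (- (x powr b)))"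
        using laplace_D[of 1 x] True by (subst nn_integral_eq_integral[OF int]) auto
      moreover have "(\<integral>\<^sup>+\<omega>. ennreal (x powr (b * a - 1)) * ennreal (exp (- x * D 1 \<omega>)) \<partial>M) = ennreal (x powr (b * a - 1)) * (\<integral>\<^sup>+\<omega>. ennreal (exp (- x * D 1 \<omega>)) \<partial>M)"
        by (rule nn_integral_cmult) simp
      ultimately show ?thesis using True by (simp add: ennreal_mult' mult.commute[of "D 1 _"])
    qed simp
  qed
  also have "\<dots> = ennreal (Gamma a / b)" by (rule nn_integral_powr_exp_powr) (use assms b in auto)
  finally have eq: "ennreal (Gamma (b * a)) * (\<integral>\<^sup>+\<omega>. ennreal (D 1 \<omega> powr (- (b * a))) \<partial>M) = ennreal (Gamma a / b)" .
  have G: "0 < Gamma (b * a)" using ba by simp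
  have "(\<integral>\<^sup>+\<omega>. ennreal (D 1 \<omega> powr (- (b * a))) \<partial>M) = ennreal (1 / Gamma (b * a)) * (ennreal (Gamma (b * a)) * (\<integral>\<^sup>+\<omega>. ennreal (D 1 \<omega> powr (- (b * a))) \<partial>M))"
    using G by (simp add: mult.assoc[symmetric] ennreal_mult[symmetric])
  also have "\<dots> = ennreal (Gamma a / (b * Gamma (b * a)))"
    unfolding eq using G b assms by (simp add: ennreal_mult[symmetric] mult.commute)
  also have "Gamma a / (b * Gamma (b * a)) = Gamma (a + 1) / Gamma (b * a + 1)"
  proof -
    have "Gamma (a + 1) = a * Gamma a" "Gamma (b * a + 1) = b * a * Gamma (b * a)"
      using assms ba by (intro Gamma_plus1; auto dest: nonpos_Ints_nonpos)+
    then show ?thesis using assms b by simp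
  qed
  finally show ?thesis .
qed

lemma inverse_process_borel_measurable: "inverse_process D t \<in> borel_measurable M"
proof (rule measurable_from_subalg[OF _ inverse_process_measurable])
  show "subalgebra M (process_measure M D)"
    unfolding subalgebra_def using process_events_subset[OF D_measurable] by simp
qed (rule D_path)

text \<open>With \<open>Z = t powr b * D 1 powr (- b)\<close>, the probability of
  \<open>x \<le> Z\<close> lies between those of \<open>x < E\<close> and of
  \<open>x \<le> E\<close>, where \<open>E\<close> is the inverse at \<open>t\<close>. The
  layer-cake formula gives the same moment from either tail, so \<open>E\<close> and
  \<open>Z\<close> have equal moments.\<close>

lemma nn_integral_inverse_process_powr:
  assumes t: "0 \<le> t" and a: "0 < a"
  shows "(\<integral>\<^sup>+\<omega>. ennreal (inverse_process D t \<omega> powr a) \<partial>M) = ennreal (Gamma (a + 1) / Gamma (b * a + 1) * t powr (b * a))"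
proof -
  let ?E = "inverse_process D t" and ?Z = "\<lambda>\<omega>. t powr b * D 1 \<omega> powr (- b)"
  note [measurable] = inverse_process_borel_measurable
  have [measurable]: "D 1 \<in> borel_measurable M" by (auto intro: D_measurable)
  note lcE = nn_integral_powr_layer_cake[of ?E, OF _ inverse_process_nonneg a]
  note lcZ = nn_integral_powr_layer_cake(1)[of ?Z a, OF _ _ a]
  have lower: "prob {\<omega> \<in> space M. x < ?E \<omega>} \<le> prob {\<omega> \<in> space M. x \<le> ?Z \<omega>}" if "0 < x" for x
  proof -
    have [measurable]: "D x \<in> borel_measurable M" using that by (auto intro: D_measurable)
    have "prob {\<omega> \<in> space M. x < ?E \<omega>} \<le> prob {\<omega> \<in> space M. D x \<omega> \<le> t}"
      using inverse_process_le[of x t D] that by (intro finite_measure_mono) (auto simp: not_le[symmetric])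
    then show ?thesis using prob_D_le_eq[OF that t] by simp
  qed
  have upper: "prob {\<omega> \<in> space M. x \<le> ?Z \<omega>} \<le> prob {\<omega> \<in> space M. x \<le> ?E \<omega>}" if "0 < x" for x
  proof -
    have [measurable]: "D x \<in> borel_measurable M" using that by (auto intro: D_measurable)
    have "prob {\<omega> \<in> space M. D x \<omega> \<le> t} \<le> prob {\<omega> \<in> space M. x \<le> ?E \<omega>}"
    proof (rule finite_measure_mono_AE)
      show "AE \<omega> in M. \<omega> \<in> {\<omega> \<in> space M. D x \<omega> \<le> t} \<longrightarrow> \<omega> \<in> {\<omega> \<in> space M. x \<le> ?E \<omega>}"
        using AE_D_unbounded[of t]
        by eventually_elim (use inverse_process_ge[of D _ x t, OF D_path] that in auto)
    qed simp
    then show ?thesis using prob_D_le_eq[OF that t] by simp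
  qed
  have "(\<integral>\<^sup>+\<omega>. ennreal (?E \<omega> powr a) \<partial>M) = (\<integral>\<^sup>+\<omega>. ennreal (?Z \<omega> powr a) \<partial>M)"
  proof (rule antisym)
    show "(\<integral>\<^sup>+\<omega>. ennreal (?E \<omega> powr a) \<partial>M) \<le> (\<integral>\<^sup>+\<omega>. ennreal (?Z \<omega> powr a) \<partial>M)"
      by (subst lcE(2), simp, subst lcZ, simp, simp, intro nn_integral_mono)
         (use lower in \<open>auto simp: indicator_def intro!: mult_left_mono ennreal_leI\<close>)
    show "(\<integral>\<^sup>+\<omega>. ennreal (?Z \<omega> powr a) \<partial>M) \<le> (\<integral>\<^sup>+\<omega>. ennreal (?E \<omega> powr a) \<partial>M)"
      by (subst lcE(1), simp, subst lcZ, simp, simp, intro nn_integral_mono)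
         (use upper in \<open>auto simp: indicator_def intro!: mult_left_mono ennreal_leI\<close>)
  qed
  also have "\<dots> = (\<integral>\<^sup>+\<omega>. ennreal (t powr (b * a)) * ennreal (D 1 \<omega> powr (- (b * a))) \<partial>M)"
    by (intro nn_integral_cong) (simp add: powr_mult powr_powr ennreal_mult)
  also have "\<dots> = ennreal (t powr (b * a)) * ennreal (Gamma (a + 1) / Gamma (b * a + 1))"
    by (subst nn_integral_cmult) (simp_all only: negative_moment_D[OF a], simp)
  also have "\<dots> = ennreal (Gamma (a + 1) / Gamma (b * a + 1) * t powr (b * a))"
    by (simp add: ennreal_mult'[symmetric] mult_ac)
  finally show ?thesis .
qed

lemma inverse_process_power_moment:
  assumes t: "0 \<le> t"
  shows "has_bochner_integral M (\<lambda>\<omega>. inverse_process D t \<omega> ^ r)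
     (fact r * rGamma (b * real r + 1) * (t powr b) ^ r)"
\<comment> \<open>The order 0 is separate: \<open>0 powr 0\<close> is 0 whereas \<open>0 ^ 0\<close>
  is 1, and the real moments need a positive exponent.\<close>
proof (cases "r = 0")
  case True
  then show ?thesis by (simp add: has_bochner_integral_iff prob_space rGamma_inverse_Gamma)
next
  case False
  note [measurable] = inverse_process_borel_measurable
  have pw: "x powr real r = x ^ r" if "0 \<le> x" for x :: real
    using that False by (cases "x = 0") (auto simp: powr_realpow)
  have G: "0 < Gamma (b * real r + 1)" using b by (intro Gamma_real_pos) (simp add: add_nonneg_pos)
  show ?thesis
  proof (rule has_bochner_integral_nn_integral)
    have "(\<integral>\<^sup>+\<omega>. ennreal (inverse_process D t \<omega> ^ r) \<partial>M) = (\<integral>\<^sup>+\<omega>. ennreal (inverse_process D t \<omega> powr real r) \<partial>M)"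
      by (simp add: pw inverse_process_nonneg)
    also have "\<dots> = ennreal (Gamma (real r + 1) / Gamma (b * real r + 1) * t powr (b * real r))"
      using False by (intro nn_integral_inverse_process_powr t) simp
    also have "Gamma (real r + 1) / Gamma (b * real r + 1) * t powr (b * real r) = fact r * rGamma (b * real r + 1) * (t powr b) ^ r"
      using Gamma_fact[of r, where 'a=real] by (simp add: pw[symmetric] powr_powr rGamma_inverse_Gamma divide_inverse add.commute)
    finally show "(\<integral>\<^sup>+\<omega>. ennreal (inverse_process D t \<omega> ^ r) \<partial>M) = ennreal (fact r * rGamma (b * real r + 1) * (t powr b) ^ r)" .
    show "0 \<le> fact r * rGamma (b * real r + 1) * (t powr b) ^ r" using G by (simp add: rGamma_inverse_Gamma)
  qed (auto simp: inverse_process_nonneg)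
qed

end

section \<open>Poisson and species processes\<close>

text \<open>A nondecreasing \<open>f\<close> approaches \<open>f s\<close> only from above, the side
  on which \<open>n\<close> is locally constant.\<close>

lemma nat_path_comp_eventually_const:
  fixes n :: "real \<Rightarrow> nat" and f :: "real \<Rightarrow> real"
  assumes n: "increasing_rc_path n" and "0 \<le> f s"
    and lim: "(f \<longlongrightarrow> f s) (at_right s)" and mono: "\<And>u. s \<le> u \<Longrightarrow> f s \<le> f u"
  shows "\<forall>\<^sub>F u in at_right s. n (f u) = n (f s)"
proof -
  from nat_path_eventually_const[OF n \<open>0 \<le> f s\<close>] obtain y where
    y: "f s < y" "\<And>v. f s < v \<Longrightarrow> v < y \<Longrightarrow> n v = n (f s)"
    by (auto simp: eventually_at_right_field)
  have "\<forall>\<^sub>F u in at_right s. f u < y" using lim y(1) by (rule order_tendstoD)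
  moreover have "\<forall>\<^sub>F u in at_right s. f s \<le> f u"
    using eventually_at_right_less[of s] by eventually_elim (simp add: mono)
  ultimately show ?thesis by eventually_elim (use y(2) in \<open>force simp: le_less\<close>)
qed

text \<open>The binomial coefficient is at most \<open>2 ^ (m + i)\<close>, which is absorbed by
  doubling the argument of the power series.\<close>

lemma summable_binomial_rGamma:
  fixes y b c :: real
  assumes "0 < b" "0 < c"
  shows "summable (\<lambda>i. real ((m + i) choose m) * y ^ (m + i) * rGamma (b * real (m + i) + c))"
proof (rule summable_comparison_test')
  have "summable (\<lambda>i. (2 * \<bar>y\<bar>) ^ i * rGamma (b * real i + c))"
    by (rule summable_power_rGamma[OF assms])
  from summable_ignore_initial_segment[OF this, of m]
  show "summable (\<lambda>i. (2 * \<bar>y\<bar>) ^ (m + i) * rGamma (b * real (m + i) + c))" by (simp add: add.commute)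
  show "norm (real ((m + i) choose m) * y ^ (m + i) * rGamma (b * real (m + i) + c)) \<le> (2 * \<bar>y\<bar>) ^ (m + i) * rGamma (b * real (m + i) + c)"
    if "0 \<le> i" for i
  proof -
    have "0 < b * real (m + i) + c" using assms by (intro add_nonneg_pos) auto
    then have r: "0 \<le> rGamma (b * real (m + i) + c)" by (simp add: rGamma_inverse_Gamma)
    have "real ((m + i) choose m) \<le> 2 ^ (m + i)" using binomial_le_pow2[of "m + i" m] by (metis of_nat_le_iff of_nat_numeral of_nat_power)
    then have "real ((m + i) choose m) * \<bar>y\<bar> ^ (m + i) * rGamma (b * real (m + i) + c) \<le> 2 ^ (m + i) * \<bar>y\<bar> ^ (m + i) * rGamma (b * real (m + i) + c)"
      using r by (intro mult_right_mono) auto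
    then show ?thesis using r by (simp add: abs_mult power_abs power_mult_distrib)
  qed
qed

section \<open>Binomial thinning and the size of one genus at a fixed age\<close>

context prob_space
begin

lemma poisson_process_pmf:
  assumes N: "poisson_process M rate N" and rate: "0 < rate" and s: "0 \<le> s" "s \<le> u"
  shows "prob {\<omega> \<in> space M. N u \<omega> - N s \<omega> = k}
      = (rate * (u - s)) ^ k / fact k * exp (- (rate * (u - s)))"
\<comment> \<open>The definition of a Poisson process gives the law of increments only for
  \<open>s < u\<close>.\<close>
proof (cases "s = u")
  case True
  then show ?thesis by (cases k) (simp_all add: prob_space)
next
  case False
  have meas: "N t \<in> measurable M (count_space UNIV)" if "0 \<le> t" for t
    using N that by (auto simp: poisson_process_def measurable_cong_sets[OF refl sets_borel_eq_count_space])
  have "prob {\<omega> \<in> space M. N u \<omega> - N s \<omega> = k} = measure (distr M (count_space UNIV) (\<lambda>\<omega>. N u \<omega> - N s \<omega>)) {k}"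
    using meas[of u] meas[of s] s by (subst measure_distr) (auto intro!: arg_cong[where f=prob])
  also have "\<dots> = pmf (poisson_pmf (rate * (u - s))) k"
    using N s False by (simp add: poisson_process_def pmf.rep_eq)
  finally show ?thesis using False s rate by simp
qed

lemma poisson_process_pmf0:
  assumes N: "poisson_process M rate N" and rate: "0 < rate" and u: "0 \<le> u"
  shows "prob {\<omega> \<in> space M. N u \<omega> = k} = (rate * u) ^ k / fact k * exp (- (rate * u))"
proof -
  have "N 0 \<omega> = 0" if "\<omega> \<in> space M" for \<omega>
    using N that by (auto simp: poisson_process_def increasing_rc_path_def)
  then have "{\<omega> \<in> space M. N u \<omega> - N 0 \<omega> = k} = {\<omega> \<in> space M. N u \<omega> = k}" by auto
  then show ?thesis using poisson_process_pmf[OF N rate order_refl u, of k] by simp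
qed

lemma poisson_process_increments:
  assumes N: "poisson_process M rate N" and u: "0 \<le> u" "u \<le> v"
  shows "prob {\<omega> \<in> space M. N u \<omega> = i \<and> N v \<omega> - N u \<omega> = j}
      = prob {\<omega> \<in> space M. N u \<omega> = i} * prob {\<omega> \<in> space M. N v \<omega> - N u \<omega> = j}"
proof -
  \<comment> \<open>The time sequence is 0, \<open>u\<close>, \<open>v\<close>, \<open>v\<close>,
    ...; its first two increments are \<open>N u\<close>, as \<open>N 0\<close> is 0, and
    \<open>N v - N u\<close>.\<close>
  define \<tau> where "\<tau> i = (if i = 0 then 0 else if i = 1 then u else v)" for i :: nat
  let ?X = "\<lambda>i \<omega>. real (N (\<tau> (Suc i)) \<omega>) - real (N (\<tau> i) \<omega>)"
  have path: "increasing_rc_path (\<lambda>t. N t \<omega>)" if "\<omega> \<in> space M" for \<omega>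
    using N that by (auto simp: poisson_process_def)
  then have N0: "N 0 \<omega> = 0" and le: "N u \<omega> \<le> N v \<omega>" if "\<omega> \<in> space M" for \<omega>
    using that u by (auto simp: increasing_rc_path_def mono_on_def)
  have "mono \<tau>" using u by (auto simp: mono_def \<tau>_def)
  have "indep_vars (\<lambda>_. borel) ?X {..<2}"
  proof -
    have "indep_increments M (\<lambda>t \<omega>. real (N t \<omega>))" using N by (simp add: poisson_process_def)
    moreover have "0 \<le> \<tau> 0" by (simp add: \<tau>_def)
    ultimately show ?thesis using \<open>mono \<tau>\<close> unfolding indep_increments_def by blast
  qed
  from indep_varsD[OF this, of "{..<2}" "\<lambda>x. if x = 0 then {real i} else {real j}"]
  have "prob (\<Inter>x\<in>{..<2}. ?X x -` (if x = 0 then {real i} else {real j}) \<inter> space M) =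
     (\<Prod>x\<in>{..<2}. prob (?X x -` (if x = 0 then {real i} else {real j}) \<inter> space M))"
    by (auto simp: lessThan_empty_iff)
  moreover have "{..<2} = {0, 1::nat}" by auto
  moreover have "?X 0 -` {real i} \<inter> space M = {\<omega> \<in> space M. N u \<omega> = i}"
    by (auto simp: \<tau>_def N0)
  moreover have "?X 1 -` {real j} \<inter> space M = {\<omega> \<in> space M. N v \<omega> - N u \<omega> = j}"
    using le by (auto simp: \<tau>_def)
  ultimately have "prob ({\<omega> \<in> space M. N u \<omega> = i} \<inter> {\<omega> \<in> space M. N v \<omega> - N u \<omega> = j})
      = prob {\<omega> \<in> space M. N u \<omega> = i} * prob {\<omega> \<in> space M. N v \<omega> - N u \<omega> = j}" by simp
  moreover have "{\<omega> \<in> space M. N u \<omega> = i} \<inter> {\<omega> \<in> space M. N v \<omega> - N u \<omega> = j} = {\<omega> \<in> space M. N u \<omega> = i \<and> N v \<omega> - N u \<omega> = j}" by auto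
  ultimately show ?thesis by simp
qed

text \<open>In the product of the two Poisson weights the exponentials and the powers of
  \<open>rate\<close> recombine into the weight for \<open>v\<close>. What is left is a binomial
  weight in \<open>u / v\<close>, that is, a Bernstein polynomial, free of
  \<open>rate\<close>.\<close>

lemma poisson_process_thinning:
  assumes N: "poisson_process M rate N" and rate: "0 < rate" and u: "0 \<le> u" "u \<le> v" "0 < v"
    and m: "m \<le> n"
  shows "prob {\<omega> \<in> space M. N u \<omega> = m \<and> N v \<omega> = n} = Bernstein n m (u / v) * prob {\<omega> \<in> space M. N v \<omega> = n}"
proof -
  have le: "N u \<omega> \<le> N v \<omega>" if "\<omega> \<in> space M" for \<omega>
    using N that u by (auto simp: poisson_process_def increasing_rc_path_def mono_on_def)
  have "{\<omega> \<in> space M. N u \<omega> = m \<and> N v \<omega> = n} = {\<omega> \<in> space M. N u \<omega> = m \<and> N v \<omega> - N u \<omega> = n - m}"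
    using le m by force
  then have "prob {\<omega> \<in> space M. N u \<omega> = m \<and> N v \<omega> = n}
     = (rate * u) ^ m / fact m * exp (- (rate * u)) * ((rate * (v - u)) ^ (n - m) / fact (n - m) * exp (- (rate * (v - u))))"
    using poisson_process_increments[OF N u(1,2)] poisson_process_pmf0[OF N rate u(1)] poisson_process_pmf[OF N rate u(1,2)] by simp
  also have "\<dots> = rate ^ m * rate ^ (n - m) * u ^ m * (v - u) ^ (n - m) / (fact m * fact (n - m)) * (exp (- (rate * u)) * exp (- (rate * (v - u))))"
    by (simp add: power_mult_distrib)
  also have "exp (- (rate * u)) * exp (- (rate * (v - u))) = exp (- (rate * v))"
    by (simp add: mult_exp_exp algebra_simps)
  also have "rate ^ m * rate ^ (n - m) = rate ^ n" using m by (simp flip: power_add)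
  also have "u ^ m = (u / v) ^ m * v ^ m" using u by (simp flip: power_mult_distrib)
  also have "(v - u) ^ (n - m) = (1 - u / v) ^ (n - m) * v ^ (n - m)" using u by (simp add: field_simps flip: power_mult_distrib)
  also have "rate ^ n * ((u / v) ^ m * v ^ m) * ((1 - u / v) ^ (n - m) * v ^ (n - m)) / (fact m * fact (n - m)) * exp (- (rate * v))
     = (fact n / (fact m * fact (n - m))) * (u / v) ^ m * (1 - u / v) ^ (n - m) * (rate ^ n * (v ^ m * v ^ (n - m)) / fact n * exp (- (rate * v)))"
    by (simp add: field_simps)
  also have "v ^ m * v ^ (n - m) = v ^ n" using m by (simp flip: power_add)
  finally show ?thesis using m poisson_process_pmf0[OF N rate, of v n] u
    by (simp add: Bernstein_def binomial_fact power_mult_distrib)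
qed

lemma indep_sets_pair:
  assumes "indep_sets F UNIV" "i \<noteq> j"
  shows "indep_set (F i) (F j)"
proof (rule indep_setI)
  show "F i \<subseteq> events" "F j \<subseteq> events" using assms(1) by (auto simp: indep_sets_def)
  fix a c assume ac: "a \<in> F i" "c \<in> F j"
  have "prob (\<Inter>x\<in>{i, j}. if x = i then a else c) = (\<Prod>x\<in>{i, j}. prob (if x = i then a else c))"
    by (rule indep_setsD[OF assms(1)]) (use ac in auto)
  then show "prob (a \<inter> c) = prob a * prob c" using assms(2) by (simp add: Int_commute)
qed

text \<open>The path starts at 1 or above, so it is no \<open>increasing_rc_path\<close>; local
  constancy is therefore stated directly, in the shape required for evaluation at an independent
  time.\<close>

lemma species_path:
  assumes Y: "species_process M lam b Y" and \<omega>: "\<omega> \<in> space M" and s: "0 \<le> s"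
  shows "\<forall>\<^sub>F u in at_right s. (Y u \<omega> = k) = (Y s \<omega> = k)"
proof -
  from Y obtain N D where N: "poisson_process M lam N" and D: "stable_subordinator M b D"
    and eq: "\<And>t. 0 \<le> t \<Longrightarrow> Y t \<omega> = 1 + N (inverse_process D t \<omega>) \<omega>"
    unfolding species_process_def using \<omega> by blast
  have "increasing_rc_path (\<lambda>t. N t \<omega>)" "increasing_rc_path (\<lambda>t. D t \<omega>)"
    using N D \<omega> by (auto simp: poisson_process_def stable_subordinator_def subordinator_def)
  then have "\<forall>\<^sub>F u in at_right s. N (inverse_process D u \<omega>) \<omega> = N (inverse_process D s \<omega>) \<omega>"
    by (rule time_changed_path_eventually_const)
  moreover have "\<forall>\<^sub>F u in at_right s. s < u" by (rule eventually_at_right_less)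
  ultimately show ?thesis by eventually_elim (use eq s in auto)
qed

text \<open>\<open>Suc m\<close> species mean \<open>m\<close> Poisson events by the inverse time
  \<open>E\<close>. The Poisson weight is expanded in powers of \<open>E\<close>; the factorial in
  the moment of order \<open>m + i\<close> combines with \<open>fact m * fact i\<close> into a
  binomial coefficient.\<close>

lemma species_law:
  assumes Y: "species_process M lam b Y" and b: "0 < b" "b < 1" and lam: "0 < lam" and u: "0 \<le> u"
  shows "(\<lambda>i. lam ^ m * (- lam) ^ i * real ((m + i) choose m) * rGamma (b * real (m + i) + 1) * (u powr b) ^ (m + i))
     sums prob {\<omega> \<in> space M. Y u \<omega> = Suc m}"
proof -
  from Y obtain N D where N: "poisson_process M lam N" and D: "stable_subordinator M b D"
    and ind: "indep_set (process_events M N) (process_events M D)"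
    and eq: "\<And>t \<omega>. 0 \<le> t \<Longrightarrow> \<omega> \<in> space M \<Longrightarrow> Y t \<omega> = 1 + N (inverse_process D t \<omega>) \<omega>"
    unfolding species_process_def by blast
  interpret D: stable_subordinator_space M b D by standard (use b D in auto)
  let ?E = "inverse_process D u"
  note [measurable] = D.inverse_process_borel_measurable
  have En: "0 \<le> ?E \<omega>" for \<omega> by (rule inverse_process_nonneg)
  let ?h = "\<lambda>x. (lam * x) ^ m / fact m * exp (- (lam * x))"
  have "{\<omega> \<in> space M. Y u \<omega> = Suc m} = {\<omega> \<in> space M. N (?E \<omega>) \<omega> = m}" using eq u by auto
  then have "ennreal (prob {\<omega> \<in> space M. Y u \<omega> = Suc m}) = ennreal (prob {\<omega> \<in> space M. N (?E \<omega>) \<omega> = m})" by simp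
  also have "\<dots> = (\<integral>\<^sup>+\<omega>. ennreal (prob {x \<in> space M. N (?E \<omega>) x = m}) * indicator (space M) \<omega> \<partial>M)"
  proof (rule prob_at_independent_time(2)[where F="process_measure M N" and G="process_measure M D"])
    show "Measurable.pred (process_measure M N) (\<lambda>\<omega>. N s \<omega> = m)" if "0 \<le> s" for s
    proof -
      have [measurable]: "N s \<in> measurable (process_measure M N) (count_space UNIV)" by (rule measurable_process_measure_nat[OF that])
      show ?thesis by measurable
    qed
    show "?E \<in> borel_measurable (process_measure M D)" by (rule inverse_process_measurable) (rule D.D_path)
    show "\<forall>\<^sub>F u in at_right s. (N u \<omega> = m) = (N s \<omega> = m)" if "\<omega> \<in> space M" "0 \<le> s" for \<omega> s
    proof -
      have "increasing_rc_path (\<lambda>t. N t \<omega>)" using N that by (auto simp: poisson_process_def)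
      from nat_path_eventually_const[OF this that(2)] show ?thesis by eventually_elim simp
    qed
    show "space M \<in> sets (process_measure M D)" by (metis sets.top space_process_measure)
  qed (use ind En in simp_all)
  also have "\<dots> = (\<integral>\<^sup>+\<omega>. ennreal (?h (?E \<omega>)) \<partial>M)"
    by (intro nn_integral_cong) (simp add: poisson_process_pmf0[OF N lam En])
  finally have pE: "ennreal (prob {\<omega> \<in> space M. Y u \<omega> = Suc m}) = (\<integral>\<^sup>+\<omega>. ennreal (?h (?E \<omega>)) \<partial>M)" .
  have "(\<integral>\<omega>. ?h (?E \<omega>) \<partial>M) = enn2real (\<integral>\<^sup>+\<omega>. ennreal (?h (?E \<omega>)) \<partial>M)"
    using En lam by (intro integral_eq_nn_integral) auto
  then have "prob {\<omega> \<in> space M. Y u \<omega> = Suc m} = (\<integral>\<omega>. ?h (?E \<omega>) \<partial>M)"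
    unfolding pE[symmetric] by simp
  moreover define f where "f i \<omega> = lam ^ m * (- lam) ^ i / (fact m * fact i) * ?E \<omega> ^ (m + i)" for i \<omega>
  have hs: "(\<lambda>i. f i \<omega>) sums ?h (?E \<omega>)" and hs': "summable (\<lambda>i. norm (f i \<omega>))" for \<omega>
  proof -
    have "(\<lambda>i. ?E \<omega> ^ m * lam ^ m / fact m * ((- (lam * ?E \<omega>)) ^ i /\<^sub>R fact i)) sums (?E \<omega> ^ m * lam ^ m / fact m * exp (- (lam * ?E \<omega>)))"
      by (intro sums_mult exp_converges)
    then show "(\<lambda>i. f i \<omega>) sums ?h (?E \<omega>)"
      by (simp add: f_def power_mult_distrib power_add power_minus[of "lam * _"] power_minus[of lam] field_simps)
    have "summable (\<lambda>i. ?E \<omega> ^ m * lam ^ m / fact m * ((lam * ?E \<omega>) ^ i /\<^sub>R fact i))"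
      using exp_converges[of "lam * ?E \<omega>"] by (intro summable_mult) (auto simp: sums_iff)
    then show "summable (\<lambda>i. norm (f i \<omega>))"
      using lam En[of \<omega>] by (simp add: f_def power_mult_distrib power_add abs_mult power_abs field_simps)
  qed
  note mom = D.inverse_process_power_moment[OF u]
  have fi: "has_bochner_integral M (f i) (lam ^ m * (- lam) ^ i * real ((m + i) choose m) * rGamma (b * real (m + i) + 1) * (u powr b) ^ (m + i))" for i
  proof -
    have "has_bochner_integral M (f i) (lam ^ m * (- lam) ^ i / (fact m * fact i) * (fact (m + i) * rGamma (b * real (m + i) + 1) * (u powr b) ^ (m + i)))"
      unfolding f_def by (intro has_bochner_integral_mult_right mom)
    then show ?thesis by (simp add: binomial_fact field_simps)
  qed
  \<comment> \<open>Expectations of the absolute terms. They have the form covered by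
    \<open>summable_binomial_rGamma\<close>, which permits the exchange of sum and integral.\<close>
  have nfi: "(\<integral>\<omega>. norm (f i \<omega>) \<partial>M) = real ((m + i) choose m) * (lam * u powr b) ^ (m + i) * rGamma (b * real (m + i) + 1)" for i
  proof -
    have "norm (f i \<omega>) = lam ^ m * lam ^ i / (fact m * fact i) * ?E \<omega> ^ (m + i)" for \<omega>
      using lam En[of \<omega>] by (simp add: f_def abs_mult power_abs)
    then have "(\<integral>\<omega>. norm (f i \<omega>) \<partial>M) = lam ^ m * lam ^ i / (fact m * fact i) * (fact (m + i) * rGamma (b * real (m + i) + 1) * (u powr b) ^ (m + i))"
      using has_bochner_integral_integral_eq[OF has_bochner_integral_mult_right[OF mom[of "m + i"], of "lam ^ m * lam ^ i / (fact m * fact i)"]] by simp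
    also have "\<dots> = real ((m + i) choose m) * (lam * u powr b) ^ (m + i) * rGamma (b * real (m + i) + 1)"
      by (simp add: binomial_fact power_mult_distrib power_add field_simps)
    finally show ?thesis .
  qed
  have "(\<lambda>i. \<integral>\<omega>. f i \<omega> \<partial>M) sums (\<integral>\<omega>. (\<Sum>i. f i \<omega>) \<partial>M)"
  proof (rule sums_integral)
    show "integrable M (f i)" for i using fi by (auto simp: has_bochner_integral_iff)
    show "summable (\<lambda>i. \<integral>\<omega>. norm (f i \<omega>) \<partial>M)" unfolding nfi by (rule summable_binomial_rGamma) (use b in auto)
  qed (use hs' in auto)
  moreover have "(\<Sum>i. f i \<omega>) = ?h (?E \<omega>)" for \<omega> using hs by (simp add: sums_iff)
  ultimately show ?thesis using fi by (simp add: has_bochner_integral_iff)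
qed

end

section \<open>Ages of the genera\<close>

text \<open>The age at time \<open>t\<close> of the \<open>j\<close>-th genus; the value 0 for genera not yet born keeps it a
  nonnegative random time measurable with respect to \<open>M\<close>.\<close>

definition genus_age :: "(real \<Rightarrow> 'a \<Rightarrow> nat) \<Rightarrow> real \<Rightarrow> nat \<Rightarrow> 'a \<Rightarrow> real" where
  "genus_age M t j \<omega> = (if j \<le> M t \<omega> then t - appearance_time M j \<omega> else 0)"

text \<open>The infimum is attained because paths are locally constant to the right. The condition
  \<open>j \<le> M t \<omega>\<close> makes the set nonempty, without which its infimum would say
  nothing.\<close>

lemma appearance_time_le_iff:
  assumes path: "increasing_rc_path (\<lambda>t. M t \<omega>)" and j: "j \<le> M t \<omega>" "0 \<le> t" and s: "0 \<le> s"
  shows "appearance_time M j \<omega> \<le> s \<longleftrightarrow> j \<le> M s \<omega>"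
proof
  let ?S = "{s. 0 \<le> s \<and> j \<le> M s \<omega>}"
  have bdd: "bdd_below ?S" by (rule bdd_belowI[of _ 0]) simp
  show "appearance_time M j \<omega> \<le> s" if "j \<le> M s \<omega>"
    unfolding appearance_time_def using that s by (intro cInf_lower bdd) simp
  assume le: "appearance_time M j \<omega> \<le> s"
  from nat_path_eventually_const[OF path s] obtain b where
    b: "s < b" "\<And>v. s < v \<Longrightarrow> v < b \<Longrightarrow> M v \<omega> = M s \<omega>"
    by (auto simp: eventually_at_right_field)
  have "Inf ?S < b" using le b by (simp add: appearance_time_def)
  then obtain v where v: "0 \<le> v" "j \<le> M v \<omega>" "v < b"
    using j bdd by (subst (asm) cInf_less_iff) auto
  show "j \<le> M s \<omega>"
  proof (cases "v \<le> s")
    case True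
    then have "M v \<omega> \<le> M s \<omega>" using path v by (auto simp: increasing_rc_path_def mono_on_def)
    then show ?thesis using v by simp
  next
    case False
    then show ?thesis using b(2)[of v] v by simp
  qed
qed

lemma appearance_time_nonneg:
  assumes "j \<le> M t \<omega>" "0 \<le> t"
  shows "0 \<le> appearance_time M j \<omega>"
  unfolding appearance_time_def using assms by (intro cInf_greatest) auto

lemma genus_age_bounds:
  assumes path: "increasing_rc_path (\<lambda>t. M t \<omega>)" and t: "0 \<le> t"
  shows "0 \<le> genus_age M t j \<omega>" "genus_age M t j \<omega> \<le> t"
  using appearance_time_le_iff[where M=M and \<omega>=\<omega>, OF path _ t t, of j] appearance_time_nonneg[of j M t \<omega>] t
  by (auto simp: genus_age_def)

text \<open>Turns tails of ages into counts of genera at an earlier time. For \<open>x > 0\<close>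
  an unborn genus, of default age 0, violates both sides.\<close>

lemma genus_age_ge_iff:
  assumes path: "increasing_rc_path (\<lambda>t. M t \<omega>)" and t: "0 \<le> t" and x: "0 < x"
  shows "x \<le> genus_age M t j \<omega> \<longleftrightarrow> x \<le> t \<and> j \<le> M (t - x) \<omega>"
proof (cases "x \<le> t")
  case True
  have "M (t - x) \<omega> \<le> M t \<omega>" using path True x by (auto simp: increasing_rc_path_def mono_on_def)
  then show ?thesis using appearance_time_le_iff[where M=M and \<omega>=\<omega>, OF path _ t, of j "t - x"] True x
    by (auto simp: genus_age_def)
next
  case False
  then show ?thesis using genus_age_bounds(2)[where M=M and \<omega>=\<omega>, OF path t, of j] by auto
qed

lemma genus_age_measurable:
  assumes path: "\<And>\<omega>. \<omega> \<in> space P \<Longrightarrow> increasing_rc_path (\<lambda>t. M t \<omega>)" and t: "0 \<le> t"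
  shows "genus_age M t j \<in> borel_measurable (process_measure P M)"
proof (rule borel_measurable_iff_ge[THEN iffD2], rule allI)
  fix x :: real
  let ?G = "process_measure P M"
  have bounds: "0 \<le> genus_age M t j \<omega>" "genus_age M t j \<omega> \<le> t" if "\<omega> \<in> space P" for \<omega>
    using genus_age_bounds[where M=M and \<omega>=\<omega>, OF path[OF that] t] by auto
  consider "x \<le> 0" | "0 < x" "x \<le> t" | "t < x" by linarith
  then show "{\<omega> \<in> space ?G. x \<le> genus_age M t j \<omega>} \<in> sets ?G"
  proof cases
    case 1
    then have "{\<omega> \<in> space ?G. x \<le> genus_age M t j \<omega>} = space ?G"
      using bounds(1) by force
    then show ?thesis by (metis sets.top)
  next
    case 2
    then have [measurable]: "M (t - x) \<in> measurable ?G (count_space UNIV)" by (intro measurable_process_measure_nat) simp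
    have "{\<omega> \<in> space ?G. j \<le> M (t - x) \<omega>} \<in> sets ?G" by measurable
    also have "{\<omega> \<in> space ?G. j \<le> M (t - x) \<omega>} = {\<omega> \<in> space ?G. x \<le> genus_age M t j \<omega>}"
      using 2 genus_age_ge_iff[where M=M, OF path t] by auto
    finally show ?thesis .
  next
    case 3
    then have "{\<omega> \<in> space ?G. x \<le> genus_age M t j \<omega>} = {}"
      using bounds(2) by force
    then show ?thesis by (metis sets.empty_sets)
  qed
qed

text \<open>The substitution \<open>x = t * y\<close> in the Beta integral. For
  \<open>b = \<nu> + 1\<close> the second factor is the tail of the age of a uniformly chosen
  genus.\<close>

lemma nn_integral_powr_Beta_scaled:
  fixes a b t :: real
  assumes "0 < a" "0 < b" "0 < t"
  shows "(\<integral>\<^sup>+x. ennreal (x powr (a - 1) * ((t - x) / t) powr (b - 1)) * indicator {0..t} x \<partial>lborel) = ennreal (t powr a * Beta a b)"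
proof -
  have "(\<integral>\<^sup>+x. ennreal (x powr (a - 1) * ((t - x) / t) powr (b - 1)) * indicator {0..t} x \<partial>lborel)
    = ennreal t * (\<integral>\<^sup>+y. ennreal ((t * y) powr (a - 1) * ((t - t * y) / t) powr (b - 1)) * indicator {0..t} (t * y) \<partial>lborel)"
    using assms by (subst nn_integral_real_affine[where c=t and t=0]) auto
  also have "\<dots> = (\<integral>\<^sup>+y. ennreal t * (ennreal ((t * y) powr (a - 1) * ((t - t * y) / t) powr (b - 1)) * indicator {0..t} (t * y)) \<partial>lborel)"
    by (rule nn_integral_cmult[symmetric]) simp
  also have "\<dots> = (\<integral>\<^sup>+y. ennreal (t powr a) * (ennreal (y powr (a - 1) * (1 - y) powr (b - 1)) * indicator {0..1} y) \<partial>lborel)"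
  proof (rule nn_integral_cong)
    fix y :: real
    have ind: "indicator {0..t} (t * y) = (indicator {0..1} y :: ennreal)"
      using assms by (auto simp: indicator_def zero_le_mult_iff)
    have "(t - t * y) / t = 1 - y" using assms by (simp add: field_simps)
    moreover have "t * (t * y) powr (a - 1) = t powr a * y powr (a - 1)" if "0 \<le> y"
      using assms that by (simp add: powr_mult powr_diff)
    ultimately show "ennreal t * (ennreal ((t * y) powr (a - 1) * ((t - t * y) / t) powr (b - 1)) * indicator {0..t} (t * y))
        = ennreal (t powr a) * (ennreal (y powr (a - 1) * (1 - y) powr (b - 1)) * indicator {0..1} y)"
      unfolding ind using assms by (auto simp: indicator_def ennreal_mult[symmetric] mult.assoc[symmetric])
  qed
  also have "\<dots> = ennreal (t powr a) * (\<integral>\<^sup>+y. ennreal (y powr (a - 1) * (1 - y) powr (b - 1)) * indicator {0..1} y \<partial>lborel)"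
    by (rule nn_integral_cmult) simp
  also have "(\<integral>\<^sup>+y. ennreal (y powr (a - 1) * (1 - y) powr (b - 1)) * indicator {0..1} y \<partial>lborel) = ennreal (Beta a b)"
    by (rule nn_integral_has_integral_lebesgue'[OF _ has_integral_Beta_real]) (use assms in auto)
  finally show ?thesis by (simp add: ennreal_mult')
qed

section \<open>Thinning of the genera and moments of their ages\<close>

context prob_space
begin

text \<open>For fixed \<open>\<omega>\<close> the path is that of \<open>N\<close> after a
  continuous nondecreasing time change starting at 0, which preserves all three path
  properties.\<close>

lemma genera_path:
  assumes M: "genera_process M \<nu> G" and \<nu>: "0 < \<nu>" and \<omega>: "\<omega> \<in> space M"
  shows "increasing_rc_path (\<lambda>t. G t \<omega>)"
proof -
  from M obtain \<mu> N W where \<mu>: "0 < \<mu>" and N: "poisson_process M 1 N" and W: "0 \<le> W \<omega>"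
    and eq: "\<And>t. 0 \<le> t \<Longrightarrow> G t \<omega> = N (W \<omega> * (\<mu> * t powr \<nu> / Gamma (1 + \<nu>))) \<omega>"
    unfolding genera_process_def using \<omega> by blast
  define f where "f t = W \<omega> * (\<mu> * t powr \<nu> / Gamma (1 + \<nu>))" for t
  have g: "0 < Gamma (1 + \<nu>)" using \<nu> by simp
  have path: "increasing_rc_path (\<lambda>t. N t \<omega>)" using N \<omega> by (auto simp: poisson_process_def)
  have f0: "0 \<le> f t" for t using W \<mu> g by (simp add: f_def)
  have fmono: "f s \<le> f t" if "0 \<le> s" "s \<le> t" for s t
    unfolding f_def using W \<mu> g \<nu> that by (intro mult_left_mono divide_right_mono powr_mono2) auto
  have lim: "(f \<longlongrightarrow> f s) (at_right s)" if "0 \<le> s" for s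
  proof -
    have "((\<lambda>t. t powr \<nu>) \<longlongrightarrow> s powr \<nu>) (at_right s)"
    proof (rule tendsto_powr')
      show "s \<noteq> 0 \<or> 0 < \<nu> \<and> (\<forall>\<^sub>F x in at_right s. 0 \<le> x)"
        using \<nu> eventually_at_right_less[of s] that by (auto elim!: eventually_mono)
    qed (auto intro: tendsto_ident_at)
    then have "((\<lambda>t. W \<omega> * (\<mu> * t powr \<nu> / Gamma (1 + \<nu>))) \<longlongrightarrow> W \<omega> * (\<mu> * s powr \<nu> / Gamma (1 + \<nu>))) (at_right s)"
      using g by (intro tendsto_mult tendsto_divide tendsto_const) auto
    then show ?thesis unfolding f_def .
  qed
  have eq': "G t \<omega> = N (f t) \<omega>" if "0 \<le> t" for t using eq[OF that] by (simp add: f_def)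
  show ?thesis unfolding increasing_rc_path_def
  proof (intro conjI allI impI)
    show "G 0 \<omega> = 0" using path by (simp add: eq increasing_rc_path_def)
    show "mono_on {0..} (\<lambda>t. G t \<omega>)"
      using path f0 fmono by (auto simp: eq' increasing_rc_path_def mono_on_def)
    fix s :: real assume s: "0 \<le> s"
    have "\<forall>\<^sub>F u in at_right s. N (f u) \<omega> = N (f s) \<omega>"
      using s by (intro nat_path_comp_eventually_const[OF path f0 lim] fmono)
    moreover have "\<forall>\<^sub>F u in at_right s. s < u" by (rule eventually_at_right_less)
    ultimately have "\<forall>\<^sub>F u in at_right s. G u \<omega> = G s \<omega>"
      by eventually_elim (use s eq' in simp)
    then show "continuous (at_right s) (\<lambda>t. G t \<omega>)"
      by (simp add: continuous_within tendsto_discrete)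
  qed
qed

lemma genus_age_borel_measurable:
  assumes M: "genera_process M \<nu> G" and \<nu>: "0 < \<nu>" and t: "0 \<le> t"
    and meas: "\<And>u. 0 \<le> u \<Longrightarrow> G u \<in> borel_measurable M"
  shows "genus_age G t j \<in> borel_measurable M"
proof (rule measurable_from_subalg[OF _ genus_age_measurable[where M=G, OF genera_path[OF M \<nu>] t]])
  show "subalgebra M (process_measure M G)"
    unfolding subalgebra_def using process_events_subset[where P=M and X=G, OF meas] by simp
qed

text \<open>Given \<open>W = w\<close>, the two counts are those of \<open>N\<close> at
  \<open>w * q s\<close> and \<open>w * q t\<close>. The quotient of these times is
  \<open>(s / t) powr \<nu>\<close> whatever \<open>w > 0\<close> is, so the binomial weight leaves
  the integral over \<open>W\<close>.\<close>

lemma genera_thinning: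
  assumes M: "genera_process M \<nu> G" and \<nu>: "0 < \<nu>" and s: "0 \<le> s" "s \<le> t" "0 < t"
    and n: "1 \<le> n" and m: "m \<le> n"
  shows "prob {\<omega> \<in> space M. G s \<omega> = m \<and> G t \<omega> = n} = Bernstein n m ((s / t) powr \<nu>) * prob {\<omega> \<in> space M. G t \<omega> = n}"
proof -
  from M obtain \<mu> N W where \<mu>: "0 < \<mu>" and N: "poisson_process M 1 N" and W: "\<And>\<omega>. \<omega> \<in> space M \<Longrightarrow> 0 \<le> W \<omega>"
    and dist: "distributed M lborel W (\<lambda>w. ennreal (genera_mixing_density \<nu> w))"
    and ind: "indep_set (process_events M N) {W -` A \<inter> space M | A. A \<in> sets borel}"
    and eq: "\<And>t \<omega>. 0 \<le> t \<Longrightarrow> \<omega> \<in> space M \<Longrightarrow> G t \<omega> = N (W \<omega> * (\<mu> * t powr \<nu> / Gamma (1 + \<nu>))) \<omega>"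
    unfolding genera_process_def by blast
  have g: "0 < Gamma (1 + \<nu>)" using \<nu> by simp
  define q where "q u = \<mu> * u powr \<nu> / Gamma (1 + \<nu>)" for u
  have q: "0 \<le> q s" "q s \<le> q t" "0 < q t"
    using \<mu> g s \<nu> by (auto simp: q_def intro!: divide_right_mono mult_left_mono powr_mono2)
  have qr: "q s / q t = (s / t) powr \<nu>" using \<mu> g s by (simp add: q_def powr_divide)
  have Wm[measurable]: "W \<in> borel_measurable M" using dist by (simp add: distributed_def)
  \<comment> \<open>The sigma-algebra generated by \<open>W\<close>, which takes the place of
    \<open>G\<close> in \<open>prob_at_independent_time\<close>.\<close>
  let ?V = "vimage_algebra (space M) W borel"
  have V: "sets ?V = {W -` A \<inter> space M | A. A \<in> sets borel}" by (rule sets_vimage_algebra2) simp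
  have path: "increasing_rc_path (\<lambda>t. N t \<omega>)" if "\<omega> \<in> space M" for \<omega>
    using N that by (auto simp: poisson_process_def)
  have scaled: "\<forall>\<^sub>F u in at_right x. N (u * a) \<omega> = N (x * a) \<omega>" if "\<omega> \<in> space M" "0 \<le> x" "0 \<le> a" for \<omega> x a
    using that by (intro nat_path_comp_eventually_const[OF path]) (auto intro!: tendsto_intros mult_right_mono)
  have Nm: "N (x * a) \<in> measurable (process_measure M N) (count_space UNIV)" if "0 \<le> x" "0 \<le> a" for x a
    using that by (intro measurable_process_measure_nat) simp
  have law: "ennreal (prob {\<omega> \<in> space M. Q (W \<omega>) \<omega>}) = (\<integral>\<^sup>+\<omega>. ennreal (prob {x \<in> space M. Q (W \<omega>) x}) \<partial>M)"
    if "\<And>x. 0 \<le> x \<Longrightarrow> Measurable.pred (process_measure M N) (Q x)"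
      and "\<And>\<omega> x. \<omega> \<in> space M \<Longrightarrow> 0 \<le> x \<Longrightarrow> \<forall>\<^sub>F u in at_right x. Q u \<omega> = Q x \<omega>" for Q
  proof -
    have "ennreal (prob {\<omega> \<in> space M. Q (W \<omega>) \<omega>}) = (\<integral>\<^sup>+\<omega>. ennreal (prob {x \<in> space M. Q (W \<omega>) x}) * indicator (space M) \<omega> \<partial>M)"
    proof (rule prob_at_independent_time(2)[where F="process_measure M N" and G="?V"])
      show "indep_set (sets (process_measure M N)) (sets ?V)" unfolding V using ind by simp
      show "W \<in> borel_measurable ?V" by (rule measurable_vimage_algebra1) simp
      show "space M \<in> sets ?V" by (metis sets.top space_vimage_algebra)
    qed (use that W in simp_all)
    also have "\<dots> = (\<integral>\<^sup>+\<omega>. ennreal (prob {x \<in> space M. Q (W \<omega>) x}) \<partial>M)" by (intro nn_integral_cong) simp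
    finally show ?thesis .
  qed
  have Gt: "prob {\<omega> \<in> space M. G t \<omega> = n} = prob {\<omega> \<in> space M. N (W \<omega> * q t) \<omega> = n}"
    using eq s by (auto intro!: arg_cong[where f=prob] simp: q_def)
  have Gst: "prob {\<omega> \<in> space M. G s \<omega> = m \<and> G t \<omega> = n} = prob {\<omega> \<in> space M. N (W \<omega> * q s) \<omega> = m \<and> N (W \<omega> * q t) \<omega> = n}"
    using eq s by (auto intro!: arg_cong[where f=prob] simp: q_def)
  let ?B = "Bernstein n m ((s / t) powr \<nu>)"
  have B: "0 \<le> ?B" using s \<nu> by (intro Bernstein_nonneg) (auto intro!: powr_le1)
  have thin: "prob {\<omega> \<in> space M. N (x * q s) \<omega> = m \<and> N (x * q t) \<omega> = n} = ?B * prob {\<omega> \<in> space M. N (x * q t) \<omega> = n}" if "0 \<le> x" for x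
  \<comment> \<open>At \<open>W = 0\<close> the quotient of times is meaningless, but
    \<open>N 0 = 0\<close> and \<open>n \<ge> 1\<close> make both events empty.\<close>
  proof (cases "x = 0")
    case True
    have "N 0 \<omega> = 0" if "\<omega> \<in> space M" for \<omega> using path[OF that] by (simp add: increasing_rc_path_def)
    then have "{\<omega> \<in> space M. N 0 \<omega> = m \<and> N 0 \<omega> = n} = {}" "{\<omega> \<in> space M. N 0 \<omega> = n} = {}" using n by auto
    then show ?thesis unfolding True mult_zero_left by (simp only: measure_empty mult_zero_right)
  next
    case False
    then have "(x * q s) / (x * q t) = (s / t) powr \<nu>" using qr by simp
    with poisson_process_thinning[OF N _ _ _ _ m, of "x * q s" "x * q t"] show ?thesis
      using False that q by (auto simp: mult_left_mono)
  qed
  have "ennreal (prob {\<omega> \<in> space M. G s \<omega> = m \<and> G t \<omega> = n})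
     = (\<integral>\<^sup>+\<omega>. ennreal (prob {x \<in> space M. N (W \<omega> * q s) x = m \<and> N (W \<omega> * q t) x = n}) \<partial>M)"
    unfolding Gst
  proof (rule law)
    fix x :: real assume x: "0 \<le> x"
    show "Measurable.pred (process_measure M N) (\<lambda>\<omega>. N (x * q s) \<omega> = m \<and> N (x * q t) \<omega> = n)"
    proof -
      note [measurable] = Nm[OF x q(1)] Nm[OF x less_imp_le[OF q(3)]]
      show ?thesis by measurable
    qed
    fix \<omega> assume \<omega>: "\<omega> \<in> space M"
    show "\<forall>\<^sub>F u in at_right x. (N (u * q s) \<omega> = m \<and> N (u * q t) \<omega> = n) = (N (x * q s) \<omega> = m \<and> N (x * q t) \<omega> = n)"
      using scaled[OF \<omega> x q(1)] scaled[OF \<omega> x less_imp_le[OF q(3)]] by eventually_elim simp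
  qed
  also have "\<dots> = (\<integral>\<^sup>+\<omega>. ennreal ?B * ennreal (prob {x \<in> space M. N (W \<omega> * q t) x = n}) \<partial>M)"
    by (intro nn_integral_cong) (simp only: thin W ennreal_mult'[OF B])
  \<comment> \<open>The probability is replaced by its explicit Poisson formula, and restored
    afterwards, to make measurability of the integrand evident when the constant is pulled
    out.\<close>
  also have "\<dots> = (\<integral>\<^sup>+\<omega>. ennreal ?B * ennreal ((W \<omega> * q t) ^ n / fact n * exp (- (W \<omega> * q t))) \<partial>M)"
    by (intro nn_integral_cong) (use W q in \<open>simp add: poisson_process_pmf0[OF N]\<close>)
  also have "\<dots> = ennreal ?B * (\<integral>\<^sup>+\<omega>. ennreal ((W \<omega> * q t) ^ n / fact n * exp (- (W \<omega> * q t))) \<partial>M)"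
    by (rule nn_integral_cmult) simp
  also have "(\<integral>\<^sup>+\<omega>. ennreal ((W \<omega> * q t) ^ n / fact n * exp (- (W \<omega> * q t))) \<partial>M) = (\<integral>\<^sup>+\<omega>. ennreal (prob {x \<in> space M. N (W \<omega> * q t) x = n}) \<partial>M)"
    by (intro nn_integral_cong) (use W q in \<open>simp add: poisson_process_pmf0[OF N]\<close>)
  also have "\<dots> = ennreal (prob {\<omega> \<in> space M. N (W \<omega> * q t) \<omega> = n})"
  proof (rule law[symmetric])
    fix x :: real assume x: "0 \<le> x"
    show "Measurable.pred (process_measure M N) (\<lambda>\<omega>. N (x * q t) \<omega> = n)"
    proof -
      note [measurable] = Nm[OF x less_imp_le[OF q(3)]]
      show ?thesis by measurable
    qed
    fix \<omega> assume \<omega>: "\<omega> \<in> space M"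
    show "\<forall>\<^sub>F u in at_right x. (N (u * q t) \<omega> = n) = (N (x * q t) \<omega> = n)"
      using scaled[OF \<omega> x less_imp_le[OF q(3)]] by eventually_elim simp
  qed
  finally show ?thesis unfolding Gt using B by (simp add: ennreal_mult'[symmetric])
qed

text \<open>On \<open>G s = m\<close> exactly \<open>m\<close> of the conditions
  \<open>j \<le> G s\<close> hold, so the sum is the expectation of \<open>G s\<close> on
  \<open>G t = n\<close>, a binomial mean.\<close>

lemma sum_prob_genera_ge:
  assumes M: "genera_process M \<nu> G" and \<nu>: "0 < \<nu>" and s: "0 \<le> s" "s \<le> t" "0 < t"
    and n: "1 \<le> n" and meas: "\<And>u. 0 \<le> u \<Longrightarrow> G u \<in> measurable M (count_space UNIV)"
  shows "(\<Sum>j=1..n. prob {\<omega> \<in> space M. j \<le> G s \<omega> \<and> G t \<omega> = n}) = real n * (s / t) powr \<nu> * prob {\<omega> \<in> space M. G t \<omega> = n}"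
proof -
  note [measurable] = meas[OF s(1)] meas[OF less_imp_le[OF s(3)]]
  have mono: "G s \<omega> \<le> G t \<omega>" if "\<omega> \<in> space M" for \<omega>
    using genera_path[OF M \<nu> that] s by (auto simp: increasing_rc_path_def mono_on_def)
  have "prob {\<omega> \<in> space M. j \<le> G s \<omega> \<and> G t \<omega> = n} = (\<Sum>m\<le>n. of_bool (j \<le> m) * prob {\<omega> \<in> space M. G s \<omega> = m \<and> G t \<omega> = n})" for j
  proof -
    have "{\<omega> \<in> space M. j \<le> G s \<omega> \<and> G t \<omega> = n} = (\<Union>m\<in>{j..n}. {\<omega> \<in> space M. G s \<omega> = m \<and> G t \<omega> = n})"
      using mono by auto
    also have "prob \<dots> = (\<Sum>m\<in>{j..n}. prob {\<omega> \<in> space M. G s \<omega> = m \<and> G t \<omega> = n})"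
      by (rule finite_measure_finite_Union) (auto simp: disjoint_family_on_def)
    also have "\<dots> = (\<Sum>m\<le>n. of_bool (j \<le> m) * prob {\<omega> \<in> space M. G s \<omega> = m \<and> G t \<omega> = n})"
      by (rule sum.mono_neutral_cong_left) auto
    finally show ?thesis .
  qed
  then have "(\<Sum>j=1..n. prob {\<omega> \<in> space M. j \<le> G s \<omega> \<and> G t \<omega> = n}) = (\<Sum>m\<le>n. \<Sum>j=1..n. of_bool (j \<le> m) * prob {\<omega> \<in> space M. G s \<omega> = m \<and> G t \<omega> = n})"
    by (simp only: sum.swap[of _ "{..n}"])
  also have "\<dots> = (\<Sum>m\<le>n. real m * prob {\<omega> \<in> space M. G s \<omega> = m \<and> G t \<omega> = n})"
  proof (intro sum.cong refl)
    fix m assume "m \<in> {..n}"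
    then have "{1..n} \<inter> {j. j \<le> m} = {1..m}" by auto
    then have "(\<Sum>j=1..n. of_bool (j \<le> m) :: real) = real m" by (simp add: sum.If_cases of_bool_def)
    then show "(\<Sum>j=1..n. of_bool (j \<le> m) * prob {\<omega> \<in> space M. G s \<omega> = m \<and> G t \<omega> = n}) = real m * prob {\<omega> \<in> space M. G s \<omega> = m \<and> G t \<omega> = n}"
      by (simp add: sum_distrib_right[symmetric])
  qed
  also have "\<dots> = (\<Sum>m\<le>n. real m * Bernstein n m ((s / t) powr \<nu>)) * prob {\<omega> \<in> space M. G t \<omega> = n}"
    unfolding sum_distrib_right by (intro sum.cong refl) (simp add: genera_thinning[OF M \<nu> s n])
  \<comment> \<open>The first moment of the Bernstein weights.\<close>
  also have "\<dots> = real n * (s / t) powr \<nu> * prob {\<omega> \<in> space M. G t \<omega> = n}" by simp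
  finally show ?thesis .
qed

text \<open>After the layer-cake formula the sum over \<open>j\<close> is moved under the integral,
  where the tails add up to a multiple of \<open>((t - x) / t) powr \<nu>\<close>; a Beta integral
  remains. The factor \<open>a\<close> of the formula is absorbed by
  \<open>Gamma (a + 1) = a * Gamma a\<close>.\<close>

lemma sum_genus_age_powr:
  assumes M: "genera_process M \<nu> G" and \<nu>: "0 < \<nu>" and t: "0 < t"
    and n: "1 \<le> n" and meas: "\<And>u. 0 \<le> u \<Longrightarrow> G u \<in> borel_measurable M" and a: "0 < a"
  shows "(\<Sum>j=1..n. \<integral>\<^sup>+\<omega>. ennreal (genus_age G t j \<omega> powr a) * indicator {\<omega> \<in> space M. G t \<omega> = n} \<omega> \<partial>M)
     = ennreal (real n * prob {\<omega> \<in> space M. G t \<omega> = n} * (t powr a * (Gamma (a + 1) * Gamma (\<nu> + 1) / Gamma (a + \<nu> + 1))))"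
proof -
  let ?p = "prob {\<omega> \<in> space M. G t \<omega> = n}"
  have meas': "G u \<in> measurable M (count_space UNIV)" if "0 \<le> u" for u
    using meas[OF that] by (simp add: measurable_cong_sets[OF refl sets_borel_eq_count_space])
  note path = genera_path[OF M \<nu>]
  have t0: "0 \<le> t" using t by simp
  note [measurable] = genus_age_borel_measurable[OF M \<nu> t0 meas]
  have [measurable]: "G t \<in> measurable M (count_space UNIV)" using meas' t by simp
  \<comment> \<open>The age is cut to 0 off the event \<open>G t = n\<close>, so that the integral
    over that event becomes a plain moment; this is harmless because \<open>0 powr a\<close> is
    0.\<close>
  define X where "X j \<omega> = genus_age G t j \<omega> * indicator {\<omega> \<in> space M. G t \<omega> = n} \<omega>" for j \<omega>
  have ge: "{\<omega> \<in> space M. x \<le> X j \<omega>} = (if x \<le> t then {\<omega> \<in> space M. j \<le> G (t - x) \<omega> \<and> G t \<omega> = n} else {})" if "0 < x" for x j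
    using that genus_age_ge_iff[where M=G, OF path t0 that, of _ j] by (auto simp: X_def indicator_def)
  have [measurable]: "X j \<in> borel_measurable M" for j unfolding X_def by measurable
  have X0: "0 \<le> X j \<omega>" if "\<omega> \<in> space M" for j \<omega>
    using genus_age_bounds(1)[where M=G, OF path[OF that] t0] by (simp add: X_def)
  \<comment> \<open>Tails are monotone in \<open>x\<close>, hence measurable, as the exchange of the
    finite sum with the integral requires.\<close>
  have [measurable]: "(\<lambda>x. prob {\<omega> \<in> space M. x \<le> X j \<omega>}) \<in> borel_measurable borel" for j
  proof -
    have "mono (\<lambda>x. - prob {\<omega> \<in> space M. x \<le> X j \<omega>})"
      by (intro monoI le_imp_neg_le finite_measure_mono) auto
    from borel_measurable_uminus[OF borel_measurable_mono[OF this]] show ?thesis by simp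
  qed
  have "(\<integral>\<^sup>+\<omega>. ennreal (genus_age G t j \<omega> powr a) * indicator {\<omega> \<in> space M. G t \<omega> = n} \<omega> \<partial>M)
    = (\<integral>\<^sup>+x. ennreal (a * x powr (a - 1)) * indicator {0<..} x * ennreal (prob {\<omega> \<in> space M. x \<le> X j \<omega>}) \<partial>lborel)" for j
  proof -
    have "(\<integral>\<^sup>+\<omega>. ennreal (genus_age G t j \<omega> powr a) * indicator {\<omega> \<in> space M. G t \<omega> = n} \<omega> \<partial>M) = (\<integral>\<^sup>+\<omega>. ennreal (X j \<omega> powr a) \<partial>M)"
      by (intro nn_integral_cong) (auto simp: X_def indicator_def)
    also have "\<dots> = (\<integral>\<^sup>+x. ennreal (a * x powr (a - 1)) * indicator {0<..} x * ennreal (prob {\<omega> \<in> space M. x \<le> X j \<omega>}) \<partial>lborel)"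
      by (rule nn_integral_powr_layer_cake(1)[OF _ X0 a]) simp
    finally show ?thesis .
  qed
  then have "(\<Sum>j=1..n. \<integral>\<^sup>+\<omega>. ennreal (genus_age G t j \<omega> powr a) * indicator {\<omega> \<in> space M. G t \<omega> = n} \<omega> \<partial>M)
     = (\<Sum>j=1..n. \<integral>\<^sup>+x. ennreal (a * x powr (a - 1)) * indicator {0<..} x * ennreal (prob {\<omega> \<in> space M. x \<le> X j \<omega>}) \<partial>lborel)"
    by (intro sum.cong refl)
  also have "\<dots> = (\<integral>\<^sup>+x. (\<Sum>j=1..n. ennreal (a * x powr (a - 1)) * indicator {0<..} x * ennreal (prob {\<omega> \<in> space M. x \<le> X j \<omega>})) \<partial>lborel)"
    by (rule nn_integral_sum[symmetric]) simp
  also have "\<dots> = (\<integral>\<^sup>+x. ennreal (a * real n * ?p) * (ennreal (x powr (a - 1) * ((t - x) / t) powr (\<nu> + 1 - 1)) * indicator {0..t} x) \<partial>lborel)"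
  proof (rule nn_integral_cong)
    fix x :: real
    have "(\<Sum>j=1..n. ennreal (a * x powr (a - 1)) * indicator {0<..} x * ennreal (prob {\<omega> \<in> space M. x \<le> X j \<omega>}))
       = ennreal (a * x powr (a - 1)) * indicator {0<..} x * ennreal (\<Sum>j=1..n. prob {\<omega> \<in> space M. x \<le> X j \<omega>})"
      by (simp add: sum_distrib_left[symmetric] sum_ennreal)
    also have "\<dots> = ennreal (a * real n * ?p) * (ennreal (x powr (a - 1) * ((t - x) / t) powr (\<nu> + 1 - 1)) * indicator {0..t} x)"
    proof (cases "0 < x \<and> x \<le> t")
      case True
      then have "(\<Sum>j=1..n. prob {\<omega> \<in> space M. x \<le> X j \<omega>}) = real n * ((t - x) / t) powr \<nu> * ?p"
        using sum_prob_genera_ge[OF M \<nu> _ _ t n meas', of "t - x"] by (simp add: ge)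
      then show ?thesis using True a by (simp add: ennreal_mult[symmetric] mult_ac)
    next
      case False
      then consider "x < 0" | "x = 0" | "t < x" "0 < x" by linarith
      then show ?thesis by cases (auto simp: ge)
    qed
    finally show "(\<Sum>j=1..n. ennreal (a * x powr (a - 1)) * indicator {0<..} x * ennreal (prob {\<omega> \<in> space M. x \<le> X j \<omega>}))
      = ennreal (a * real n * ?p) * (ennreal (x powr (a - 1) * ((t - x) / t) powr (\<nu> + 1 - 1)) * indicator {0..t} x)" .
  qed
  also have "\<dots> = ennreal (a * real n * ?p) * ennreal (t powr a * Beta a (\<nu> + 1))"
    using \<nu> by (subst nn_integral_cmult) (simp_all only: nn_integral_powr_Beta_scaled[OF a _ t], simp_all)
  also have "\<dots> = ennreal (real n * ?p * (t powr a * (Gamma (a + 1) * Gamma (\<nu> + 1) / Gamma (a + \<nu> + 1))))"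
  proof -
    have "Gamma (a + 1) = a * Gamma a" using a by (intro Gamma_plus1) (auto dest: nonpos_Ints_nonpos)
    then have "a * real n * ?p * (t powr a * Beta a (\<nu> + 1)) = real n * ?p * (t powr a * (Gamma (a + 1) * Gamma (\<nu> + 1) / Gamma (a + \<nu> + 1)))"
      by (simp add: Beta_def add.assoc)
    then show ?thesis using a by (simp only: ennreal_mult'[symmetric, of "a * real n * ?p"] mult_nonneg_nonneg measure_nonneg of_nat_0_le_iff less_imp_le)
  qed
  finally show ?thesis .
qed

end

section \<open>Size of a uniformly chosen genus\<close>

lemma rGamma_mult_Gamma:
  fixes x :: real
  assumes "0 < x"
  shows "rGamma x * Gamma x = 1"
  using Gamma_real_pos[OF assms] by (auto simp: rGamma_inverse_Gamma)

context prob_space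
begin

lemma sum_genus_age_power:
  assumes M: "genera_process M \<nu> G" and \<nu>: "0 < \<nu>" and t: "0 < t" and b: "0 < b"
    and n: "1 \<le> n" and meas: "\<And>u. 0 \<le> u \<Longrightarrow> G u \<in> borel_measurable M"
  shows "integrable M (\<lambda>\<omega>. (genus_age G t j \<omega> powr b) ^ r * indicator {\<omega> \<in> space M. G t \<omega> = n} \<omega>)" (is ?int)
    and "(\<Sum>j=1..n. \<integral>\<omega>. (genus_age G t j \<omega> powr b) ^ r * indicator {\<omega> \<in> space M. G t \<omega> = n} \<omega> \<partial>M)
     = real n * prob {\<omega> \<in> space M. G t \<omega> = n} * (t powr b) ^ r * (Gamma (b * real r + 1) * Gamma (\<nu> + 1) * rGamma (b * real r + \<nu> + 1))" (is ?sum)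
proof -
  let ?p = "prob {\<omega> \<in> space M. G t \<omega> = n}" and ?A = "{\<omega> \<in> space M. G t \<omega> = n}"
  have t0: "0 \<le> t" using t by simp
  note path = genera_path[OF M \<nu>]
  have [measurable]: "G t \<in> measurable M (count_space UNIV)"
    using meas[OF t0] by (simp add: measurable_cong_sets[OF refl sets_borel_eq_count_space])
  note [measurable] = genus_age_borel_measurable[OF M \<nu> t0 meas]
  have int: "integrable M (\<lambda>\<omega>. (genus_age G t j \<omega> powr b) ^ r * indicator ?A \<omega>)" for j
  proof (rule integrable_const_bound[where B="(t powr b) ^ r"])
    show "AE \<omega> in M. norm ((genus_age G t j \<omega> powr b) ^ r * indicator ?A \<omega>) \<le> (t powr b) ^ r"
    proof (rule AE_I2)
      fix \<omega> assume "\<omega> \<in> space M"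
      then have "0 \<le> genus_age G t j \<omega>" "genus_age G t j \<omega> \<le> t"
        using genus_age_bounds[where M=G, OF path t0] by auto
      then have "(genus_age G t j \<omega> powr b) ^ r \<le> (t powr b) ^ r"
        using b by (intro power_mono powr_mono2) auto
      then show "norm ((genus_age G t j \<omega> powr b) ^ r * indicator ?A \<omega>) \<le> (t powr b) ^ r"
        by (auto simp: indicator_def)
    qed
  qed measurable
  then show ?int .
  show ?sum
  \<comment> \<open>The layer-cake route needs a positive exponent; for \<open>r = 0\<close> both
    sides count \<open>n\<close> times the probability of \<open>G t = n\<close>.\<close>
  proof (cases "r = 0")
    case True
    have "Gamma (\<nu> + 1) * rGamma (\<nu> + 1) = 1" using rGamma_mult_Gamma[of "\<nu> + 1"] \<nu> by (simp add: mult.commute)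
    then show ?thesis using True by simp
  next
    case False
    have pw: "(x powr b) ^ r = x powr (b * real r)" for x :: real
      using False by (cases "x = 0") (auto simp: powr_powr powr_realpow[symmetric])
    let ?R = "real n * ?p * (t powr (b * real r) * (Gamma (b * real r + 1) * Gamma (\<nu> + 1) / Gamma (b * real r + \<nu> + 1)))"
    have br: "0 < b * real r" using False b by simp
    have R: "0 \<le> ?R" using br \<nu> by (intro mult_nonneg_nonneg divide_nonneg_nonneg) (auto intro!: less_imp_le[OF Gamma_real_pos] add_pos_pos)
    have "ennreal (\<Sum>j=1..n. \<integral>\<omega>. (genus_age G t j \<omega> powr b) ^ r * indicator ?A \<omega> \<partial>M)
        = (\<Sum>j=1..n. ennreal (\<integral>\<omega>. (genus_age G t j \<omega> powr b) ^ r * indicator ?A \<omega> \<partial>M))"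
      by (rule sum_ennreal[symmetric]) (auto intro!: integral_nonneg_AE)
    also have "\<dots> = (\<Sum>j=1..n. \<integral>\<^sup>+\<omega>. ennreal ((genus_age G t j \<omega> powr b) ^ r * indicator ?A \<omega>) \<partial>M)"
      by (intro sum.cong refl nn_integral_eq_integral[symmetric] int) auto
    also have "\<dots> = (\<Sum>j=1..n. \<integral>\<^sup>+\<omega>. ennreal (genus_age G t j \<omega> powr (b * real r)) * indicator ?A \<omega> \<partial>M)"
      by (intro sum.cong refl nn_integral_cong) (simp add: pw indicator_def)
    also have "\<dots> = ennreal ?R" by (rule sum_genus_age_powr[OF M \<nu> t n meas br])
    finally have "(\<Sum>j=1..n. \<integral>\<omega>. (genus_age G t j \<omega> powr b) ^ r * indicator ?A \<omega> \<partial>M) = ?R"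
      using R by (subst (asm) ennreal_inj) (auto intro!: sum_nonneg integral_nonneg_AE)
    then show ?thesis by (simp add: pw rGamma_inverse_Gamma divide_inverse mult.assoc)
  qed
qed

text \<open>\<open>Y\<close> is evaluated at an age that depends on the genera only, hence is
  independent of \<open>Y\<close>; the series for a fixed age is then integrated term by term. The
  first part certifies that the event belongs to the model, so that independence of the chosen index
  applies to it.\<close>

lemma genus_size_prob:
  fixes Y :: "real \<Rightarrow> 'a \<Rightarrow> nat"
  assumes M: "genera_process M \<nu> G" and \<nu>: "0 < \<nu>" and t: "0 < t"
    and Y: "species_process M lam b Y" and b: "0 < b" "b < 1" and lam: "0 < lam"
    and meas: "\<And>u. 0 \<le> u \<Longrightarrow> G u \<in> borel_measurable M"
    and ind: "indep_set (process_events M Y) (process_events M G)" and n: "1 \<le> n"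
  shows "{\<omega> \<in> space M. G t \<omega> = n \<and> Y (genus_age G t j \<omega>) \<omega> = k}
      \<in> sigma_sets (space M) (process_events M Y \<union> process_events M G)" (is ?set)
    and "(\<lambda>i. lam ^ m * (- lam) ^ i * real ((m + i) choose m) * rGamma (b * real (m + i) + 1) *
         (\<integral>\<omega>. (genus_age G t j \<omega> powr b) ^ (m + i) * indicator {\<omega> \<in> space M. G t \<omega> = n} \<omega> \<partial>M))
      sums prob {\<omega> \<in> space M. G t \<omega> = n \<and> Y (genus_age G t j \<omega>) \<omega> = Suc m}" (is ?sums)
proof -
  let ?A = "{\<omega> \<in> space M. G t \<omega> = n}" and ?age = "genus_age G t j"
  have t0: "0 \<le> t" using t by simp
  note path = genera_path[OF M \<nu>]
  have age0: "0 \<le> ?age \<omega>" and aget: "?age \<omega> \<le> t" if "\<omega> \<in> space M" for \<omega>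
    using genus_age_bounds[where M=G, OF path[OF that] t0] by auto
  have [measurable]: "G t \<in> measurable (process_measure M G) (count_space UNIV)"
    by (rule measurable_process_measure_nat[OF t0])
  have "{\<omega> \<in> space (process_measure M G). G t \<omega> = n} \<in> sets (process_measure M G)" by measurable
  then have A: "?A \<in> sets (process_measure M G)" by simp
  have Ae[measurable]: "?A \<in> events" using A process_events_subset[where P=M and X=G, OF meas] by auto
  note [measurable] = genus_age_borel_measurable[OF M \<nu> t0 meas]
  have ind': "indep_set (sets (process_measure M Y)) (sets (process_measure M G))" using ind by simp
  have Ym: "Measurable.pred (process_measure M Y) (\<lambda>\<omega>. Y s \<omega> = l)" if "0 \<le> s" for s l
  proof -
    note [measurable] = measurable_process_measure_nat[of s Y M, OF that]
    show ?thesis by measurable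
  qed
  note rt = prob_at_independent_time[OF space_process_measure space_process_measure ind' Ym species_path[OF Y]
      genus_age_measurable[where M=G, OF path t0] age0 A]
  have "{\<omega> \<in> ?A. Y (?age \<omega>) \<omega> = k} \<in> sigma_sets (space M) (sets (process_measure M Y) \<union> sets (process_measure M G))"
    by (rule rt(1))
  then show ?set by (simp add: conj_assoc)
  define p where "p u = prob {\<omega> \<in> space M. Y u \<omega> = Suc m}" for u
  define c where "c i = lam ^ m * (- lam) ^ i * real ((m + i) choose m) * rGamma (b * real (m + i) + 1)" for i
  define f where "f i \<omega> = c i * ((?age \<omega> powr b) ^ (m + i) * indicator ?A \<omega>)" for i \<omega>
  have fs: "(\<lambda>i. f i \<omega>) sums (p (?age \<omega>) * indicator ?A \<omega>)" if "\<omega> \<in> space M" for \<omega>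
    using sums_mult2[OF species_law[OF Y b lam age0[OF that], of m], of "indicator ?A \<omega>"]
    by (simp add: f_def c_def p_def mult_ac)
  \<comment> \<open>An age never exceeds \<open>t\<close>, which dominates the terms uniformly in
    \<open>\<omega>\<close>.\<close>
  have bnd: "norm (f i \<omega>) \<le> real ((m + i) choose m) * (lam * t powr b) ^ (m + i) * rGamma (b * real (m + i) + 1)" if "\<omega> \<in> space M" for i \<omega>
  proof -
    have "0 < b * real (m + i) + 1" using b by (intro add_nonneg_pos) auto
    then have r: "0 \<le> rGamma (b * real (m + i) + 1)" by (simp add: rGamma_inverse_Gamma)
    have "norm (f i \<omega>) = lam ^ (m + i) * real ((m + i) choose m) * rGamma (b * real (m + i) + 1) * (?age \<omega> powr b) ^ (m + i) * indicator ?A \<omega>"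
      using lam r by (simp add: f_def c_def abs_mult power_abs power_add)
    also have "\<dots> \<le> lam ^ (m + i) * real ((m + i) choose m) * rGamma (b * real (m + i) + 1) * (t powr b) ^ (m + i) * 1"
      using lam r b age0[OF that] aget[OF that]
      by (intro mult_mono mult_nonneg_nonneg power_mono powr_mono2) (auto simp: indicator_def)
    finally show ?thesis by (simp add: power_mult_distrib mult_ac)
  qed
  have summ: "summable (\<lambda>i. real ((m + i) choose m) * (lam * t powr b) ^ (m + i) * rGamma (b * real (m + i) + 1))"
    by (rule summable_binomial_rGamma) (use b in auto)
  have [measurable]: "f i \<in> borel_measurable M" for i unfolding f_def by measurable
  have int: "integrable M (f i)" for i
    by (rule integrable_const_bound[OF AE_I2[OF bnd]]) auto
  have sums: "(\<lambda>i. \<integral>\<omega>. f i \<omega> \<partial>M) sums (\<integral>\<omega>. (\<Sum>i. f i \<omega>) \<partial>M)"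
  proof (rule sums_integral[OF int])
    show "AE \<omega> in M. summable (\<lambda>i. norm (f i \<omega>))"
      by (rule AE_I2, rule summable_comparison_test'[OF summ, of 0]) (use bnd in auto)
    show "summable (\<lambda>i. \<integral>\<omega>. norm (f i \<omega>) \<partial>M)"
    proof (rule summable_comparison_test'[OF summ, of 0])
      fix i :: nat
      have "(\<integral>\<omega>. norm (f i \<omega>) \<partial>M) \<le> (\<integral>\<omega>. real ((m + i) choose m) * (lam * t powr b) ^ (m + i) * rGamma (b * real (m + i) + 1) \<partial>M)"
        by (rule integral_mono) (use int bnd in auto)
      then show "norm (\<integral>\<omega>. norm (f i \<omega>) \<partial>M) \<le> real ((m + i) choose m) * (lam * t powr b) ^ (m + i) * rGamma (b * real (m + i) + 1)"
        by (simp add: prob_space)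
    qed
  qed
  have eq: "(\<integral>\<omega>. (\<Sum>i. f i \<omega>) \<partial>M) = prob {\<omega> \<in> space M. G t \<omega> = n \<and> Y (?age \<omega>) \<omega> = Suc m}"
  proof -
    have S: "(\<Sum>i. f i \<omega>) = p (?age \<omega>) * indicator ?A \<omega>" if "\<omega> \<in> space M" for \<omega>
      using fs[OF that] by (simp add: sums_iff)
    have "(\<integral>\<omega>. (\<Sum>i. f i \<omega>) \<partial>M) = enn2real (\<integral>\<^sup>+\<omega>. ennreal (\<Sum>i. f i \<omega>) \<partial>M)"
      by (rule integral_eq_nn_integral) (auto simp: S p_def)
    also have "(\<integral>\<^sup>+\<omega>. ennreal (\<Sum>i. f i \<omega>) \<partial>M) = (\<integral>\<^sup>+\<omega>. ennreal (p (?age \<omega>)) * indicator ?A \<omega> \<partial>M)"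
      by (rule nn_integral_cong) (auto simp: S indicator_def)
    also have "\<dots> = ennreal (prob {\<omega> \<in> ?A. Y (?age \<omega>) \<omega> = Suc m})"
      unfolding p_def by (rule rt(2)[symmetric])
    also have "{\<omega> \<in> ?A. Y (?age \<omega>) \<omega> = Suc m} = {\<omega> \<in> space M. G t \<omega> = n \<and> Y (?age \<omega>) \<omega> = Suc m}" by auto
    finally show ?thesis by simp
  qed
  show ?sums using sums unfolding eq by (simp add: f_def c_def)
qed

text \<open>Summing the term-by-term series over \<open>j\<close> brings in the age moments. The
  Gamma factor in their numerators cancels the reciprocal Gamma coming from the inverse
  subordinator, and the rest is a Prabhakar series.\<close>

lemma sum_genus_size_prob:
  fixes Y :: "nat \<Rightarrow> real \<Rightarrow> 'a \<Rightarrow> nat"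
  assumes M: "genera_process M \<nu> G" and \<nu>: "0 < \<nu>" and t: "0 < t"
    and Y: "\<And>j. 1 \<le> j \<Longrightarrow> species_process M lam b (Y j)" and b: "0 < b" "b < 1" and lam: "0 < lam"
    and meas: "\<And>u. 0 \<le> u \<Longrightarrow> G u \<in> borel_measurable M"
    and ind: "\<And>j. 1 \<le> j \<Longrightarrow> indep_set (process_events M (Y j)) (process_events M G)" and n: "1 \<le> n"
  shows "(\<Sum>j=1..n. prob {\<omega> \<in> space M. G t \<omega> = n \<and> Y j (genus_age G t j \<omega>) \<omega> = Suc m})
    = real n * prob {\<omega> \<in> space M. G t \<omega> = n} *
      (Gamma (\<nu> + 1) * lam ^ m * t powr (b * real m) * prabhakar (real m + 1) b (b * real m + \<nu> + 1) (- lam * t powr b))"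
proof -
  let ?p = "prob {\<omega> \<in> space M. G t \<omega> = n}"
  define c where "c i = lam ^ m * (- lam) ^ i * real ((m + i) choose m) * rGamma (b * real (m + i) + 1)" for i
  define I where "I j r = (\<integral>\<omega>. (genus_age G t j \<omega> powr b) ^ r * indicator {\<omega> \<in> space M. G t \<omega> = n} \<omega> \<partial>M)" for j r
  define e where "e i = pochhammer (real m + 1) i * (- lam * t powr b) ^ i / fact i * rGamma (b * real i + (b * real m + \<nu> + 1))" for i
  let ?C = "real n * ?p * (Gamma (\<nu> + 1) * lam ^ m * t powr (b * real m))"
  have e: "e i = real ((m + i) choose m) * (- lam * t powr b) ^ i * rGamma (b * real (m + i) + (\<nu> + 1))" for i
  proof -
    \<comment> \<open>The rising factorial in the Prabhakar coefficient is the binomial coefficient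
      produced by the Poisson expansion.\<close>
    have "pochhammer (real m + 1) i / fact i = real ((m + i) choose m)"
      using pochhammer_product[of m "m + i" "1 :: real"] by (simp add: binomial_fact pochhammer_fact[symmetric] add.commute)
    moreover have "b * real i + (b * real m + \<nu> + 1) = b * real (m + i) + (\<nu> + 1)" by (simp add: distrib_left)
    moreover have "e i = pochhammer (real m + 1) i / fact i * (- lam * t powr b) ^ i * rGamma (b * real i + (b * real m + \<nu> + 1))"
      by (simp add: e_def)
    ultimately show ?thesis by (simp only:)
  qed
  have ce: "c i * (\<Sum>j=1..n. I j (m + i)) = ?C * e i" for i
  proof -
    have "0 < b * real (m + i) + 1" using b by (intro add_nonneg_pos) auto
    then have G: "rGamma (b * real (m + i) + 1) * Gamma (b * real (m + i) + 1) = 1"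
      by (rule rGamma_mult_Gamma)
    have "c i * (\<Sum>j=1..n. I j (m + i)) = c i * (real n * ?p * (t powr b) ^ (m + i) * (Gamma (b * real (m + i) + 1) * Gamma (\<nu> + 1) * rGamma (b * real (m + i) + \<nu> + 1)))"
      unfolding I_def using sum_genus_age_power(2)[OF M \<nu> t b(1) n meas, of "m + i"] by simp
    also have "\<dots> = (rGamma (b * real (m + i) + 1) * Gamma (b * real (m + i) + 1)) *
       (real n * ?p * (Gamma (\<nu> + 1) * lam ^ m * (t powr b) ^ m) * (real ((m + i) choose m) * ((- lam) ^ i * (t powr b) ^ i) * rGamma (b * real (m + i) + \<nu> + 1)))"
      unfolding c_def power_add by (simp only: mult_ac)
    also have "(t powr b) ^ m = t powr (b * real m)" using t by (simp add: powr_powr powr_realpow[symmetric])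
    finally show ?thesis unfolding G e by (simp add: power_mult_distrib[symmetric] add.assoc)
  qed
  have "(\<lambda>i. \<Sum>j=1..n. c i * I j (m + i)) sums (\<Sum>j=1..n. prob {\<omega> \<in> space M. G t \<omega> = n \<and> Y j (genus_age G t j \<omega>) \<omega> = Suc m})"
    unfolding c_def I_def by (intro sums_sum genus_size_prob(2)[OF M \<nu> t Y b lam meas ind n]) auto
  then have sums: "(\<lambda>i. ?C * e i) sums (\<Sum>j=1..n. prob {\<omega> \<in> space M. G t \<omega> = n \<and> Y j (genus_age G t j \<omega>) \<omega> = Suc m})"
    by (simp only: sum_distrib_left[symmetric] ce)
  \<comment> \<open>Not deduced from the convergence of \<open>?C * e i\<close>, because
    \<open>?C\<close> vanishes if \<open>G t = n\<close> is a null event.\<close>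
  have "summable e"
  proof -
    have "summable (\<lambda>i. real ((m + i) choose m) * (lam * t powr b) ^ (m + i) * rGamma (b * real (m + i) + (\<nu> + 1)))"
      by (rule summable_binomial_rGamma) (use b \<nu> in auto)
    then have "summable (\<lambda>i. real ((m + i) choose m) * (lam * t powr b) ^ (m + i) * rGamma (b * real (m + i) + (\<nu> + 1)) / (lam * t powr b) ^ m)"
      by (rule summable_divide)
    moreover have "norm (e i) = real ((m + i) choose m) * (lam * t powr b) ^ (m + i) * rGamma (b * real (m + i) + (\<nu> + 1)) / (lam * t powr b) ^ m" for i
    proof -
      have "0 < b * real (m + i) + (\<nu> + 1)" using b \<nu> by (intro add_nonneg_pos) auto
      then have "0 \<le> rGamma (b * real (m + i) + (\<nu> + 1))" by (simp add: rGamma_inverse_Gamma)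
      then show ?thesis unfolding e power_add[of "lam * t powr b"] using lam t by (simp add: abs_mult power_abs)
    qed
    ultimately have "summable (\<lambda>i. norm (e i))" by simp
    then show "summable e" by (rule summable_norm_cancel)
  qed
  then have "(\<lambda>i. ?C * e i) sums (?C * suminf e)" by (intro sums_mult summable_sums)
  with sums have "(\<Sum>j=1..n. prob {\<omega> \<in> space M. G t \<omega> = n \<and> Y j (genus_age G t j \<omega>) \<omega> = Suc m}) = ?C * suminf e"
    by (rule sums_unique2)
  moreover have "suminf e = prabhakar (real m + 1) b (b * real m + \<nu> + 1) (- lam * t powr b)"
    unfolding prabhakar_def e_def ..
  ultimately show ?thesis by (simp only: mult.assoc)
qed

end

text \<open>On \<open>M t = n\<close> the event is split by the value of \<open>J\<close>;
  independence of \<open>J\<close> turns its probability into the average over \<open>j\<close> of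
  those of \<open>A n j\<close>, which is \<open>R * p n\<close>. As \<open>R\<close> is free of
  \<open>n\<close>, summing over \<open>n \<ge> 1\<close> and dividing gives
  \<open>R\<close>.\<close>

theorem mainTheorem4:
  fixes P :: "'a measure" and \<nu> \<beta> lam t :: real and k :: nat
    and M :: "real \<Rightarrow> 'a \<Rightarrow> nat" and Y :: "nat \<Rightarrow> real \<Rightarrow> 'a \<Rightarrow> nat" and J :: "'a \<Rightarrow> nat"
  assumes "0 < \<nu>" "\<nu> < 1" and "0 < \<beta>" "\<beta> < 1" and "0 < lam"
    and "generalized_yule_model P \<nu> lam \<beta> M Y"
    and "0 < t"
    and "uniform_genus_index P M Y t J"
    and "1 \<le> k"
  shows "\<P>(\<omega> in P. chosen_genus_size M Y t J \<omega> = k \<bar> 1 \<le> M t \<omega>) =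
      Gamma (\<nu> + 1) * lam ^ (k - 1) * t powr (\<beta> * real k - \<beta>) *
      prabhakar (real k) \<beta> (\<beta> * real k - \<beta> + \<nu> + 1) (- lam * t powr \<beta>)"
proof -
  obtain m where k: "k = Suc m" using assms(9) by (cases k) auto
  have model: "prob_space P" "genera_process P \<nu> M" "\<And>i. 1 \<le> i \<Longrightarrow> species_process P lam \<beta> (Y i)"
    and indep: "prob_space.indep_sets P (\<lambda>i. process_events P (if i = 0 then M else Y i)) UNIV"
    using assms(6) by (auto simp: generalized_yule_model_def)
  interpret prob_space P by (rule model)
  \<comment> \<open>Measurability of the genera and species is read off from the independence
    condition, whose members must be events.\<close>
  have ev: "process_events P M \<subseteq> events" "\<And>i. 1 \<le> i \<Longrightarrow> process_events P (Y i) \<subseteq> events"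
  proof -
    have *: "process_events P (if i = 0 then M else Y i) \<subseteq> events" for i
      using indep unfolding indep_sets_def by blast
    show "process_events P M \<subseteq> events" using *[of 0] by simp
    show "process_events P (Y i) \<subseteq> events" if "1 \<le> i" for i using *[of i] that by simp
  qed
  have ind: "indep_set (process_events P (Y i)) (process_events P M)" if "1 \<le> i" for i
    using indep_sets_pair[OF indep, of i 0] that by simp
  have meas: "M u \<in> borel_measurable P" if "0 \<le> u" for u
    using measurable_process_measure[OF that, of M P] ev(1) by (auto simp: measurable_def)
  have t0: "0 \<le> t" using assms(7) by simp
  have Mt[measurable]: "M t \<in> measurable P (count_space UNIV)"
    using meas[OF t0] by (simp add: measurable_cong_sets[OF refl sets_borel_eq_count_space])
  have J[measurable]: "J \<in> measurable P (count_space UNIV)"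
    and Jin: "\<And>\<omega>. \<omega> \<in> space P \<Longrightarrow> 1 \<le> M t \<omega> \<Longrightarrow> J \<omega> \<in> {1..M t \<omega>}"
    and Junif: "\<And>n j. 1 \<le> n \<Longrightarrow> j \<in> {1..n} \<Longrightarrow> \<P>(\<omega> in P. J \<omega> = j \<bar> M t \<omega> = n) = 1 / real n"
    and Jind: "\<And>n j A. 1 \<le> n \<Longrightarrow> j \<in> {1..n} \<Longrightarrow>
        A \<in> sigma_sets (space P) (process_events P M \<union> (\<Union>i\<in>{1..}. process_events P (Y i))) \<Longrightarrow>
        \<P>(\<omega> in P. J \<omega> = j \<and> \<omega> \<in> A \<bar> M t \<omega> = n) = \<P>(\<omega> in P. J \<omega> = j \<bar> M t \<omega> = n) * \<P>(\<omega> in P. \<omega> \<in> A \<bar> M t \<omega> = n)"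
    using assms(8) unfolding uniform_genus_index_def
    by (auto simp: measurable_cong_sets[OF refl sets_borel_eq_count_space])
  define p where "p n = prob {\<omega> \<in> space P. M t \<omega> = n}" for n
  define A where "A n j = {\<omega> \<in> space P. M t \<omega> = n \<and> Y j (genus_age M t j \<omega>) \<omega> = k}" for n j
  define R where "R = Gamma (\<nu> + 1) * lam ^ m * t powr (\<beta> * real m) * prabhakar (real m + 1) \<beta> (\<beta> * real m + \<nu> + 1) (- lam * t powr \<beta>)"
  \<comment> \<open>Division by zero yields 0, so a conditional probability equal to
    \<open>1 / n\<close> can only come from a condition of positive probability.\<close>
  have p0: "p n \<noteq> 0" if "1 \<le> n" for n
    using Junif[OF that, of 1] that by (auto simp: cond_prob_def p_def)
  have Asig: "A n j \<in> sigma_sets (space P) (process_events P (Y j) \<union> process_events P M)" if "1 \<le> n" "1 \<le> j" for n j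
    unfolding A_def
    by (rule genus_size_prob(1)[OF model(2) assms(1,7) model(3)[OF that(2)] assms(3,4,5) meas ind[OF that(2)] that(1)])
  have A[measurable]: "A n j \<in> events" if "1 \<le> n" "1 \<le> j" for n j
    using Asig[OF that] ev(1) ev(2)[OF that(2)] sets.sigma_sets_subset[of "process_events P (Y j) \<union> process_events P M" P] by blast
  have Aunif: "prob {\<omega> \<in> A n j. J \<omega> = j} = 1 / real n * prob (A n j)" if n: "1 \<le> n" and j: "j \<in> {1..n}" for n j
  proof -
    have j1: "1 \<le> j" using j by simp
    then have sub: "process_events P (Y j) \<union> process_events P M \<subseteq> process_events P M \<union> (\<Union>i\<in>{1..}. process_events P (Y i))"
      by blast
    have "A n j \<in> sigma_sets (space P) (process_events P M \<union> (\<Union>i\<in>{1..}. process_events P (Y i)))"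
      by (rule subsetD[OF sigma_sets_mono'[OF sub] Asig[OF n j1]])
    from Jind[OF n j this] have "prob {\<omega> \<in> space P. (J \<omega> = j \<and> \<omega> \<in> A n j) \<and> M t \<omega> = n} / p n
        = 1 / real n * (prob {\<omega> \<in> space P. \<omega> \<in> A n j \<and> M t \<omega> = n} / p n)"
      unfolding Junif[OF n j] by (simp only: cond_prob_def p_def)
    moreover have "{\<omega> \<in> space P. (J \<omega> = j \<and> \<omega> \<in> A n j) \<and> M t \<omega> = n} = {\<omega> \<in> A n j. J \<omega> = j}"
      "{\<omega> \<in> space P. \<omega> \<in> A n j \<and> M t \<omega> = n} = A n j" by (auto simp: A_def)
    ultimately show ?thesis using p0[OF n] n by (simp add: field_simps)
  qed
  define B where "B n = {\<omega> \<in> space P. chosen_genus_size M Y t J \<omega> = k \<and> M t \<omega> = n}" for n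
  \<comment> \<open>On \<open>M t = n\<close> the index \<open>J\<close> lies in
    \<open>{1..n}\<close>, so the chosen genus is born and \<open>genus_age\<close> is its true age,
    not the default 0.\<close>
  have Beq: "B n = (\<Union>j\<in>{1..n}. {\<omega> \<in> A n j. J \<omega> = j})" if "1 \<le> n" for n
    using Jin that by (auto simp: B_def A_def chosen_genus_size_def genus_age_def)
  have AJ[measurable]: "{\<omega> \<in> A n j. J \<omega> = j} \<in> events" if "1 \<le> n" "1 \<le> j" for n j
  proof -
    have "{\<omega> \<in> A n j. J \<omega> = j} = A n j \<inter> {\<omega> \<in> space P. J \<omega> = j}" by (auto simp: A_def)
    then show ?thesis using A[OF that] by simp
  qed
  have Bev: "B n \<in> events" if "1 \<le> n" for n
    unfolding Beq[OF that] using AJ[OF that] by (intro sets.finite_UN) auto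
  have Bp: "prob (B n) = R * p n" if n: "1 \<le> n" for n
  proof -
    have "prob (B n) = (\<Sum>j=1..n. prob {\<omega> \<in> A n j. J \<omega> = j})"
      unfolding Beq[OF n] using AJ[OF n]
      by (intro finite_measure_finite_Union) (auto simp: disjoint_family_on_def)
    also have "\<dots> = 1 / real n * (\<Sum>j=1..n. prob (A n j))"
      unfolding sum_distrib_left by (intro sum.cong refl Aunif n)
    also have "(\<Sum>j=1..n. prob (A n j)) = real n * p n * R"
      unfolding A_def p_def R_def k by (rule sum_genus_size_prob[OF model(2) assms(1,7) model(3) assms(3,4,5) meas ind n])
    finally show ?thesis using n by simp
  qed
  have s1: "(\<lambda>n. prob (B (Suc n))) sums prob (\<Union>n. B (Suc n))"
    by (rule finite_measure_UNION) (use Bev in \<open>auto simp: disjoint_family_on_def B_def\<close>)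
  have s2: "(\<lambda>n. p (Suc n)) sums prob (\<Union>n. {\<omega> \<in> space P. M t \<omega> = Suc n})"
    unfolding p_def by (rule finite_measure_UNION) (auto simp: disjoint_family_on_def)
  have U1: "(\<Union>n. B (Suc n)) = {\<omega> \<in> space P. chosen_genus_size M Y t J \<omega> = k \<and> 1 \<le> M t \<omega>}"
    by (auto simp: B_def Suc_le_eq gr0_conv_Suc)
  have U2: "(\<Union>n. {\<omega> \<in> space P. M t \<omega> = Suc n}) = {\<omega> \<in> space P. 1 \<le> M t \<omega>}"
    by (auto simp: Suc_le_eq gr0_conv_Suc)
  have "(\<lambda>n. prob (B (Suc n))) sums (R * prob {\<omega> \<in> space P. 1 \<le> M t \<omega>})"
    using sums_mult[OF s2, of R] by (simp add: Bp U2)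
  with s1 have eq: "prob {\<omega> \<in> space P. chosen_genus_size M Y t J \<omega> = k \<and> 1 \<le> M t \<omega>} = R * prob {\<omega> \<in> space P. 1 \<le> M t \<omega>}"
    unfolding U1 by (rule sums_unique2)
  have "p 1 \<le> prob {\<omega> \<in> space P. 1 \<le> M t \<omega>}"
    unfolding p_def by (rule finite_measure_mono) auto
  moreover have "0 < p 1" using p0[of 1] by (simp add: p_def zero_less_measure_iff)
  ultimately have "prob {\<omega> \<in> space P. 1 \<le> M t \<omega>} \<noteq> 0" by linarith
  then have "\<P>(\<omega> in P. chosen_genus_size M Y t J \<omega> = k \<bar> 1 \<le> M t \<omega>) = R"
    unfolding cond_prob_def eq by simp
  also have "R = Gamma (\<nu> + 1) * lam ^ (k - 1) * t powr (\<beta> * real k - \<beta>) *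
      prabhakar (real k) \<beta> (\<beta> * real k - \<beta> + \<nu> + 1) (- lam * t powr \<beta>)"
  proof -
    have "\<beta> * real k - \<beta> = \<beta> * real m" "real m + 1 = real k" "k - 1 = m" by (simp_all add: k algebra_simps)
    then show ?thesis unfolding R_def by (simp only:)
  qed
  finally show ?thesis .
qed

end
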